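(* Let $\zeta$ be an aperiodic primitive constant-shape substitution on $\mathbb{Z}^d$ with finite alphabet $\mathcal{A}$, expansion matrix $L$ and support $F_1$, and let $(Y,S,\mathbb{Z}^d)$, with $Y\subseteq\mathcal{B}^{\mathbb{Z}^d}$ for a finite alphabet $\mathcal{B}$, be an aperiodic symbolic factor of the substitutive subshift $(X_\zeta,S,\mathbb{Z}^d)$. Then there exist an integer $n\ge 1$ and an aperiodic primitive constant-shape substitution $\zeta'$ with a finite alphabet $\mathcal{C}$, having the same expansion matrix and support as $\zeta^n$ (namely $L^n$ and $F_n$), and a conjugacy $\tau':(X_{\zeta'},S,\mathbb{Z}^d)\to(Y,S,\mathbb{Z}^d)$ induced by a letter-to-letter map, i.e. there is a map $T':\mathcal{C}\to\mathcal{B}$ with $\tau'(x)_{k}=T'(x_{k})$ for all $x\in X_{\zeta'}$ and $k\in\mathbb{Z}^d$.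
   Context: Let $d\ge 1$; $\|\cdot\|$ is the Euclidean norm on $\mathbb{R}^d$ and the induced operator norm on matrices. For a finite alphabet $\mathcal{A}$, $\mathcal{A}^{\mathbb{Z}^d}$ carries the product topology and the shift action $(S^{n}x)_{k}=x_{n+k}$. A subshift is a closed shift-invariant subset; it is aperiodic if none of its points $x$ has a nonzero period (a $p\in\mathbb{Z}^d\setminus\{0\}$ with $x_{k+p}=x_k$ for all $k$). A pattern is an element of $\mathcal{A}^P$ with $P\subset\mathbb{Z}^d$ finite (patterns are identified up to translation of the support); it occurs in $x$ at $n$ if it equals $x|_{n+P}$. Constant-shape substitution: let $L$ be a $d\times d$ integer matrix with $\|L\|>1$, $\|L^{-1}\|<1$ (expansion matrix), and let $F_1\subset\mathbb{Z}^d$ be a set of representatives of $\mathbb{Z}^d/L(\mathbb{Z}^d)$ with $0\in F_1$ (support). A constant-shape substitution is a map $\zeta:\mathcal{A}\to\mathcal{A}^{F_1}$. It extends to $\mathcal{A}^{\mathbb{Z}^d}$ by $\zeta(x)_{L(j)+f}=\zeta(x_j)_f$ ($j\in\mathbb{Z}^d$, $f\in F_1$). Its iterates $\zeta^n:\mathcal{A}\to\mathcal{A}^{F_n}$ have expansion matrix $L^n$ and support $F_n$, where $F_{n+1}=F_1+L(F_n)$, and $\zeta^{n+1}(a)_{L(g)+f}=\zeta(\zeta^n(a)_g)_f$ for $g\in F_n,f\in F_1$. Standing assumption: $(F_n)_{n>0}$ is a Følner sequence, i.e. $|F_n\,\Delta\,(m+F_n)|/|F_n|\to0$ for every $m\in\mathbb{Z}^d$.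 $\zeta$ is primitive if for some $n>0$ every letter occurs in $\zeta^n(a)$ for every $a\in\mathcal{A}$. $X_\zeta$ is the subshift of all $x\in\mathcal{A}^{\mathbb{Z}^d}$ such that every pattern occurring in $x$ occurs in some $\zeta^n(a)$, $n>0$, $a\in\mathcal{A}$. $\zeta$ is aperiodic if $X_\zeta$ is. A factor map between subshifts is a continuous surjection commuting with the shift actions; a conjugacy is an invertible factor map. An aperiodic symbolic factor is an aperiodic subshift that is the image of a factor map. *)

theory Defs
  imports "HOL-Analysis.Analysis"
begin

section \<open>Configurations and subshifts\<close>

text \<open>
  The group $\mathbb{Z}^d$ is the type \<^typ>\<open>int^'d\<close> with \<^typ>\<open>'d\<close> finite, and an alphabet is a set.
  Configurations over \<^term>\<open>A\<close> are the functions on \<^typ>\<open>int^'d\<close> with values in \<^term>\<open>A\<close>,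
  which is the carrier of the following topology.
\<close>

definition config_topology :: "'a set \<Rightarrow> (int^'d::finite \<Rightarrow> 'a) topology" where
  "config_topology A = product_topology (\<lambda>_. discrete_topology A) UNIV"

lemma topspace_config_topology: "topspace (config_topology A) = {x. \<forall>k. x k \<in> A}"
  by (auto simp: config_topology_def)

definition shift :: "int^'d \<Rightarrow> (int^'d \<Rightarrow> 'a) \<Rightarrow> (int^'d \<Rightarrow> 'a)" where
  "shift n x = (\<lambda>k. x (n + k))"

definition subshift :: "'a set \<Rightarrow> (int^'d::finite \<Rightarrow> 'a) set \<Rightarrow> bool" where
  "subshift A X \<longleftrightarrow> closedin (config_topology A) X \<and> (\<forall>n. \<forall>x\<in>X. shift n x \<in> X)"

definition aperiodic :: "(int^'d \<Rightarrow> 'a) set \<Rightarrow> bool" where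
  "aperiodic X \<longleftrightarrow> (\<forall>x\<in>X. \<not> (\<exists>p. p \<noteq> 0 \<and> (\<forall>k. x (k + p) = x k)))"

definition factor_map ::
  "'a set \<Rightarrow> (int^'d::finite \<Rightarrow> 'a) set \<Rightarrow> 'b set \<Rightarrow> (int^'d \<Rightarrow> 'b) set \<Rightarrow>
   ((int^'d \<Rightarrow> 'a) \<Rightarrow> (int^'d \<Rightarrow> 'b)) \<Rightarrow> bool" where
  "factor_map A X B Y \<tau> \<longleftrightarrow>
     continuous_map (subtopology (config_topology A) X) (subtopology (config_topology B) Y) \<tau> \<and>
     \<tau> ` X = Y \<and>
     (\<forall>n. \<forall>x\<in>X. \<tau> (shift n x) = shift n (\<tau> x))"

definition conjugacy ::
  "'a set \<Rightarrow> (int^'d::finite \<Rightarrow> 'a) set \<Rightarrow> 'b set \<Rightarrow> (int^'d \<Rightarrow> 'b) set \<Rightarrow>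
   ((int^'d \<Rightarrow> 'a) \<Rightarrow> (int^'d \<Rightarrow> 'b)) \<Rightarrow> bool" where
  "conjugacy A X B Y \<tau> \<longleftrightarrow>
     factor_map A X B Y \<tau> \<and>
     (\<exists>\<sigma>. factor_map B Y A X \<sigma> \<and> (\<forall>x\<in>X. \<sigma> (\<tau> x) = x) \<and> (\<forall>y\<in>Y. \<tau> (\<sigma> y) = y))"

definition aperiodic_symbolic_factor ::
  "'a set \<Rightarrow> (int^'d::finite \<Rightarrow> 'a) set \<Rightarrow> 'b set \<Rightarrow> (int^'d \<Rightarrow> 'b) set \<Rightarrow> bool" where
  "aperiodic_symbolic_factor A X B Y \<longleftrightarrow>
     subshift B Y \<and> aperiodic Y \<and> (\<exists>\<tau>. factor_map A X B Y \<tau>)"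

text \<open>
  The pattern \<^term>\<open>w\<close> with support \<^term>\<open>P\<close> occurs in the array \<^term>\<open>y\<close>, of which only the
  values on the domain \<^term>\<open>D\<close> count, up to a translation of the support.
\<close>

definition occurs_in :: "(int^'d) set \<Rightarrow> (int^'d \<Rightarrow> 'a) \<Rightarrow> (int^'d) set \<Rightarrow> (int^'d \<Rightarrow> 'a) \<Rightarrow> bool" where
  "occurs_in P w D y \<longleftrightarrow> (\<exists>n. \<forall>k\<in>P. n + k \<in> D \<and> y (n + k) = w k)"


section \<open>Expansion matrices and supports\<close>

abbreviation real_matrix :: "int^'n^'m \<Rightarrow> real^'n^'m" where
  "real_matrix \<equiv> map_matrix real_of_int"

definition op_norm :: "real^'n::finite^'m::finite \<Rightarrow> real" where
  "op_norm M = onorm (\<lambda>v. M *v v)"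

definition expansion_matrix :: "int^'d::finite^'d \<Rightarrow> bool" where
  "expansion_matrix L \<longleftrightarrow>
     invertible (real_matrix L) \<and>
     op_norm (real_matrix L) > 1 \<and> op_norm (matrix_inv (real_matrix L)) < 1"

text \<open>The power operation of the type class on vectors is componentwise, hence not usable here.\<close>

primrec mat_pow :: "int^'d::finite^'d \<Rightarrow> nat \<Rightarrow> int^'d^'d" where
  "mat_pow L 0 = mat 1"
| "mat_pow L (Suc n) = L ** mat_pow L n"

definition representatives :: "int^'d::finite^'d \<Rightarrow> (int^'d) set \<Rightarrow> bool" where
  "representatives L F \<longleftrightarrow> (\<forall>k. \<exists>!f. f \<in> F \<and> k - f \<in> range (\<lambda>j. L *v j))"

text \<open>
  The supports $F_n$ of the iterates, starting with $F_0 = \{0\}$ so that $F_1$ is the given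
  support.
\<close>

primrec iter_support :: "int^'d::finite^'d \<Rightarrow> (int^'d) set \<Rightarrow> nat \<Rightarrow> (int^'d) set" where
  "iter_support L F 0 = {0}"
| "iter_support L F (Suc n) = {f + L *v g | f g. f \<in> F \<and> g \<in> iter_support L F n}"

lemma iter_support_1: "iter_support L F 1 = F"
  by simp

definition foelner :: "(nat \<Rightarrow> (int^'d::finite) set) \<Rightarrow> bool" where
  "foelner F \<longleftrightarrow>
     (\<forall>m. (\<lambda>n. real (card (sym_diff (F n) ((\<lambda>k. m + k) ` F n))) / real (card (F n)))
            \<longlonglongrightarrow> 0)"


section \<open>Constant-shape substitutions\<close>

text \<open>
  A substitution assigns to a letter \<^term>\<open>a\<close> the pattern \<^term>\<open>\<zeta> a\<close>, of which only the values on
  the support \<^term>\<open>F\<close> count.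
\<close>

definition constant_shape_substitution ::
  "'a set \<Rightarrow> int^'d::finite^'d \<Rightarrow> (int^'d) set \<Rightarrow> ('a \<Rightarrow> int^'d \<Rightarrow> 'a) \<Rightarrow> bool" where
  "constant_shape_substitution A L F \<zeta> \<longleftrightarrow>
     finite A \<and> A \<noteq> {} \<and>
     expansion_matrix L \<and>
     representatives L F \<and> 0 \<in> F \<and>
     foelner (iter_support L F) \<and>
     (\<forall>a\<in>A. \<forall>f\<in>F. \<zeta> a f \<in> A)"

text \<open>The unique decomposition $k = L(j) + f$ with $f$ in \<^term>\<open>F\<close>.\<close>

definition decomp :: "int^'d::finite^'d \<Rightarrow> (int^'d) set \<Rightarrow> int^'d \<Rightarrow> (int^'d) \<times> (int^'d)" where
  "decomp L F k = (THE (j, f). f \<in> F \<and> k = L *v j + f)"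

definition subst_ext ::
  "int^'d::finite^'d \<Rightarrow> (int^'d) set \<Rightarrow> ('a \<Rightarrow> int^'d \<Rightarrow> 'a) \<Rightarrow> (int^'d \<Rightarrow> 'a) \<Rightarrow> (int^'d \<Rightarrow> 'a)" where
  "subst_ext L F \<zeta> x = (\<lambda>k. case decomp L F k of (j, f) \<Rightarrow> \<zeta> (x j) f)"

text \<open>
  The pattern $\zeta^n(a)$ is the restriction of the following array to the support $F_n$; the
  values elsewhere are immaterial.
\<close>

primrec iter_subst ::
  "int^'d::finite^'d \<Rightarrow> (int^'d) set \<Rightarrow> ('a \<Rightarrow> int^'d \<Rightarrow> 'a) \<Rightarrow> nat \<Rightarrow> 'a \<Rightarrow> int^'d \<Rightarrow> 'a" where
  "iter_subst L F \<zeta> 0 a = (\<lambda>_. a)"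
| "iter_subst L F \<zeta> (Suc n) a = subst_ext L F \<zeta> (iter_subst L F \<zeta> n a)"

definition primitive_subst ::
  "'a set \<Rightarrow> int^'d::finite^'d \<Rightarrow> (int^'d) set \<Rightarrow> ('a \<Rightarrow> int^'d \<Rightarrow> 'a) \<Rightarrow> bool" where
  "primitive_subst A L F \<zeta> \<longleftrightarrow>
     (\<exists>n>0. \<forall>a\<in>A. \<forall>b\<in>A. \<exists>f\<in>iter_support L F n. iter_subst L F \<zeta> n a f = b)"

definition subst_shift ::
  "'a set \<Rightarrow> int^'d::finite^'d \<Rightarrow> (int^'d) set \<Rightarrow> ('a \<Rightarrow> int^'d \<Rightarrow> 'a) \<Rightarrow> (int^'d \<Rightarrow> 'a) set" where
  "subst_shift A L F \<zeta> =
     {x. (\<forall>k. x k \<in> A) \<and>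
         (\<forall>P w. finite P \<and> occurs_in P w UNIV x \<longrightarrow>
            (\<exists>n>0. \<exists>a\<in>A. occurs_in P w (iter_support L F n) (iter_subst L F \<zeta> n a)))}"

definition aperiodic_subst ::
  "'a set \<Rightarrow> int^'d::finite^'d \<Rightarrow> (int^'d) set \<Rightarrow> ('a \<Rightarrow> int^'d \<Rightarrow> 'a) \<Rightarrow> bool" where
  "aperiodic_subst A L F \<zeta> \<longleftrightarrow> aperiodic (subst_shift A L F \<zeta>)"


section \<open>The defining equations of the extension and of the iterates\<close>

lemma real_matrix_mult_vec:
  "real_matrix L *v (\<chi> i. real_of_int (v $ i)) = (\<chi> i. real_of_int ((L *v v) $ i))"
  by (simp add: matrix_vector_mult_def vec_eq_iff)

lemma expansion_matrix_inj:
  fixes L :: "int^'d::finite^'d"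
  assumes "expansion_matrix L"
  shows "inj ((*v) L)"
proof (rule injI)
  fix u v :: "int^'d"
  assume "L *v u = L *v v"
  then have "real_matrix L *v (\<chi> i. real_of_int (u $ i)) = real_matrix L *v (\<chi> i. real_of_int (v $ i))"
    by (simp only: real_matrix_mult_vec)
  moreover have "inj ((*v) (real_matrix L))"
    using assms by (simp add: expansion_matrix_def inj_matrix_vector_mult)
  ultimately have "(\<chi> i. real_of_int (u $ i)) = (\<chi> i. real_of_int (v $ i))"
    by (rule injD[rotated])
  then show "u = v"
    by (simp add: vec_eq_iff)
qed

lemma decomp_eq:
  assumes L: "expansion_matrix L" and F: "representatives L F" and f: "f \<in> F"
  shows "decomp L F (L *v j + f) = (j, f)"
  unfolding decomp_def
proof (rule the_equality)
  show "case (j, f) of (j', f') \<Rightarrow> f' \<in> F \<and> L *v j + f = L *v j' + f'"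
    using f by simp
next
  fix q
  assume q: "case q of (j', f') \<Rightarrow> f' \<in> F \<and> L *v j + f = L *v j' + f'"
  obtain j' f' where jf: "q = (j', f')"
    by (cases q)
  with q have f': "f' \<in> F" and eq: "L *v j + f = L *v j' + f'"
    by auto
  have "L *v j + f - f \<in> range (\<lambda>j. L *v j)" and "L *v j + f - f' \<in> range (\<lambda>j. L *v j)"
    by (simp, simp add: eq)
  with F f f' have "f' = f"
    unfolding representatives_def by blast
  with eq expansion_matrix_inj[OF L] show "q = (j, f)"
    by (simp add: jf inj_eq)
qed

lemma subst_ext_eq:
  assumes "constant_shape_substitution A L F \<zeta>" and "f \<in> F"
  shows "subst_ext L F \<zeta> x (L *v j + f) = \<zeta> (x j) f"
  using assms by (simp add: subst_ext_def constant_shape_substitution_def decomp_eq)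

lemma iter_subst_eq:
  assumes "constant_shape_substitution A L F \<zeta>" and "f \<in> F"
  shows "iter_subst L F \<zeta> (Suc n) a (L *v g + f) = \<zeta> (iter_subst L F \<zeta> n a g) f"
  using assms by (simp add: subst_ext_eq)

end

theory Submission
  imports Defs "HOL-Library.Diagonal_Subsequence"
begin

text \<open>
  Let $\tau : X_\zeta \to Y$ be the factor map. Call two points of $X_\zeta$ equivalent at level $n$
  if the images of their level-$n$ supertiles at the origin, that is $\tau(\zeta^n x)$ restricted to
  $F_n$, agree. There are finitely many such equivalence relations and each determines the next
  one, so for some $n \ge 1$ the levels $n$ and $2n$ coincide. Then $\zeta^n$ induces a substitution
  on the pairs of a class and a position in $F_n$, and the letter of $y \in Y$ at $k$ is read off the
  supertile of $y$ that contains $k$.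

  This is well defined if the phase modulo $L^n$ of $y$ is unique, i.e. if $Y$ is recognizable.
  The number of phases of $y$ modulo $L^n$ is bounded uniformly in $n$: two desubstitutions of $y$
  with distinct phases that agree on a window containing all small patterns would give a period of
  a point of $Y$. Hence the coincidences of phases at all levels have bounded order. As every
  coincidence at level $n$ lifts to the levels $m > n$, while the kernels of the powers of $L$ modulo
  a bounded number stabilise, there are none.
\<close>

section \<open>Powers of an expansion matrix\<close>

text \<open>The image under \<tau> of a supertile also depends on the neighbouring supertiles, so
  the equivalences live on points of \<open>X\<close> and not on letters. One finite window
  \<open>D\<close> serves all levels; this makes the set of equivalences finite and the bound on
  phases uniform. A letter carries a position because a letter-to-letter map must read off a single
  symbol. The point u with y = shift f (T n u) need not be unique: recognizability fixes only f
  modulo L^n. That suffices, since y and its phase determine the images of all supertiles, hence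
  their classes. Coding points of \<open>Y\<close>, rather than of \<open>X\<close>, makes the
  coding inverse to the letter map. Torsion at a single level is not enough, as e p in L^n Z^d does
  not force p to lie there; passing to a higher level supplies the divisibility by e that permits
  cancelling it.\<close>

lemma mat_pow_add: "mat_pow L (m + n) = mat_pow L m ** mat_pow L n"
  by (induction m) (simp_all add: matrix_mul_assoc)

lemma mat_pow_Suc_vec: "mat_pow L (Suc n) *v v = L *v (mat_pow L n *v v)"
  by (simp add: matrix_vector_mul_assoc)

lemma mat_pow_add_vec: "mat_pow L (m + n) *v v = mat_pow L m *v (mat_pow L n *v v)"
  by (simp add: matrix_vector_mul_assoc mat_pow_add)

declare mat_pow.simps(2) [simp del]

text \<open>Digit expansion in base L: low digits in F_m, high digits stretched by L^m. It splits a
  supertile of level m + n into supertiles of level m indexed by F_n.\<close>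

lemma iter_support_add:
  "iter_support L F (m + n) = {f + mat_pow L m *v g | f g. f \<in> iter_support L F m \<and> g \<in> iter_support L F n}"
proof (induction m)
  case 0
  then show ?case by auto
next
  case (Suc m)
  show ?case (is "?l = ?r")
  proof (intro set_eqI iffI)
    fix v assume "v \<in> ?l"
    then obtain f a b where "f \<in> F" "a \<in> iter_support L F m" "b \<in> iter_support L F n"
      "v = f + L *v (a + mat_pow L m *v b)"
      using Suc by auto
    then show "v \<in> ?r"
      by (force simp: mat_pow_Suc_vec matrix_vector_right_distrib algebra_simps)
  next
    fix v assume "v \<in> ?r"
    then obtain f a b where "f \<in> F" "a \<in> iter_support L F m" "b \<in> iter_support L F n"
      "v = (f + L *v a) + mat_pow L (Suc m) *v b"
      by auto
    moreover have "(f + L *v a) + mat_pow L (Suc m) *v b = f + L *v (a + mat_pow L m *v b)"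
      by (simp add: mat_pow_Suc_vec matrix_vector_right_distrib algebra_simps)
    ultimately show "v \<in> ?l"
      using Suc by auto
  qed
qed

lemma iter_support_mult:
  "iter_support (mat_pow L n) (iter_support L F n) m = iter_support L F (n * m)"
  by (induction m) (simp_all add: iter_support_add)

section \<open>Integer vectors, operator norms and expansion matrices\<close>

definition real_vec :: "int^'d \<Rightarrow> real^'d" where
  "real_vec v = (\<chi> i. real_of_int (v $ i))"

lemma real_vec_mult: "real_vec (L *v v) = real_matrix L *v real_vec v"
  by (simp add: real_vec_def real_matrix_mult_vec)

lemma real_vec_add: "real_vec (v + w) = real_vec v + real_vec w"
  by (simp add: real_vec_def vec_eq_iff)

lemma real_vec_diff: "real_vec (v - w) = real_vec v - real_vec w"
  by (simp add: real_vec_def vec_eq_iff)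

lemma finite_vec_coordinates:
  assumes "finite (S :: int set)"
  shows "finite {v :: int^'d::finite. \<forall>i. v $ i \<in> S}"
proof -
  have "{v :: int^'d. \<forall>i. v $ i \<in> S} \<subseteq> vec_lambda ` (PiE UNIV (\<lambda>_. S))"
    by (auto simp: image_iff intro!: bexI[of _ "vec_nth _"])
  then show ?thesis
    using assms by (meson finite_PiE finite finite_imageI finite_subset)
qed

lemma finite_int_ball: "finite {v :: int^'d::finite. norm (real_vec v) \<le> r}"
proof (rule finite_subset)
  show "{v :: int^'d. norm (real_vec v) \<le> r} \<subseteq> {v. \<forall>i. v $ i \<in> {-\<lceil>r\<rceil>..\<lceil>r\<rceil>}}"
  proof clarify
    fix v :: "int^'d" and i assume "norm (real_vec v) \<le> r"
    then have "\<bar>real_of_int (v $ i)\<bar> \<le> r"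
      using component_le_norm_cart[of "real_vec v" i] by (simp add: real_vec_def)
    then show "v $ i \<in> {-\<lceil>r\<rceil>..\<lceil>r\<rceil>}"
      by (simp; linarith)
  qed
  show "finite {v :: int^'d. \<forall>i. v $ i \<in> {-\<lceil>r\<rceil>..\<lceil>r\<rceil>}}"
    by (rule finite_vec_coordinates) simp
qed

lemma bounded_linear_matrix: "bounded_linear (\<lambda>v. M *v (v :: real^'n::finite))"
  by simp

lemma op_norm_mult: "op_norm (M ** N) \<le> op_norm M * op_norm N"
  using onorm_compose[OF bounded_linear_matrix[of M] bounded_linear_matrix[of N]]
  by (simp add: op_norm_def o_def matrix_vector_mul_assoc)

lemma op_norm_nonneg: "0 \<le> op_norm M"
  by (simp add: op_norm_def onorm_pos_le)

lemma op_norm_vec: "norm (M *v v) \<le> op_norm M * norm v"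
  unfolding op_norm_def by (rule onorm) simp

lemma
  fixes M :: "real^'n::finite^'n"
  assumes "invertible M"
  shows matrix_inv_right: "M ** matrix_inv M = mat 1"
    and matrix_inv_left: "matrix_inv M ** M = mat 1"
  using someI_ex[OF assms[unfolded invertible_def]] by (simp_all add: matrix_inv_def)

lemma matrix_inv_unique:
  fixes M :: "real^'n::finite^'n"
  assumes "M ** N = mat 1"
  shows "matrix_inv M = N"
proof -
  have "N ** M = mat 1"
    using assms matrix_left_right_inverse by blast
  then have "invertible M"
    using assms by (auto simp: invertible_def)
  then have "matrix_inv M ** (M ** N) = N"
    by (simp add: matrix_mul_assoc matrix_inv_left)
  then show ?thesis
    by (simp add: assms)
qed

text \<open>From 1 = ||M M^-1|| \<le> ||M|| ||M^-1||, a contracting inverse already forces ||M|| >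
  1, so only the inverse has to be estimated for powers.\<close>

lemma expansion_matrixI:
  fixes L :: "int^'d::finite^'d"
  assumes "invertible (real_matrix L)" and less: "op_norm (matrix_inv (real_matrix L)) < 1"
  shows "expansion_matrix L"
proof -
  have "1 = op_norm (mat 1 :: real^'d^'d)"
    by (simp add: op_norm_def onorm_id)
  also have "\<dots> = op_norm (real_matrix L ** matrix_inv (real_matrix L))"
    using assms by (simp add: matrix_inv_right)
  also have "\<dots> \<le> op_norm (real_matrix L) * op_norm (matrix_inv (real_matrix L))"
    by (rule op_norm_mult)
  finally have *: "1 \<le> op_norm (real_matrix L) * op_norm (matrix_inv (real_matrix L))" .
  have "op_norm (real_matrix L) > 1"
  proof (rule ccontr)
    assume "\<not> ?thesis"
    then have "op_norm (real_matrix L) * op_norm (matrix_inv (real_matrix L))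
      \<le> 1 * op_norm (matrix_inv (real_matrix L))"
      by (intro mult_right_mono) (auto simp: op_norm_nonneg)
    with * less show False by simp
  qed
  then show ?thesis
    using assms by (simp add: expansion_matrix_def)
qed

lemma real_matrix_mult: "real_matrix (L ** M) = real_matrix L ** real_matrix M"
  by (simp add: matrix_matrix_mult_def vec_eq_iff map_matrix_def)

lemma expansion_matrix_mult:
  fixes L M :: "int^'d::finite^'d"
  assumes "expansion_matrix L" "expansion_matrix M"
  shows "expansion_matrix (L ** M)"
proof (rule expansion_matrixI)
  let ?L = "real_matrix L" and ?M = "real_matrix M"
  have inv: "invertible ?L" "invertible ?M"
    using assms by (auto simp: expansion_matrix_def)
  then show "invertible (real_matrix (L ** M))"
    by (simp add: real_matrix_mult invertible_mult)
  have "(?L ** ?M) ** (matrix_inv ?M ** matrix_inv ?L) = mat 1"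
    using inv by (metis matrix_inv_right matrix_mul_assoc matrix_mul_rid)
  then have "matrix_inv (real_matrix (L ** M)) = matrix_inv ?M ** matrix_inv ?L"
    by (simp add: real_matrix_mult matrix_inv_unique)
  then have "op_norm (matrix_inv (real_matrix (L ** M))) \<le> op_norm (matrix_inv ?M) * op_norm (matrix_inv ?L)"
    by (simp add: op_norm_mult)
  also have "\<dots> \<le> op_norm (matrix_inv ?M) * 1"
    using assms by (intro mult_left_mono) (auto simp: expansion_matrix_def op_norm_nonneg)
  also have "\<dots> < 1"
    using assms by (auto simp: expansion_matrix_def)
  finally show "op_norm (matrix_inv (real_matrix (L ** M))) < 1" .
qed

lemma expansion_matrix_pow:
  assumes "expansion_matrix L" "n \<ge> 1"
  shows "expansion_matrix (mat_pow L n)"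
  using assms(2)
proof (induction n rule: dec_induct)
  case base
  then show ?case using assms(1) by (simp add: mat_pow.simps(2))
next
  case (step n)
  then show ?case using assms(1) by (simp add: mat_pow.simps(2) expansion_matrix_mult)
qed

lemma expansion_matrix_norm:
  assumes "expansion_matrix L"
  shows "norm (real_vec v) \<le> op_norm (matrix_inv (real_matrix L)) * norm (real_vec (L *v v))"
proof -
  have "real_vec v = matrix_inv (real_matrix L) *v real_vec (L *v v)"
    using assms by (simp add: real_vec_mult matrix_vector_mul_assoc matrix_inv_left expansion_matrix_def)
  then show ?thesis
    by (metis op_norm_vec)
qed

text \<open>Each residue class has a point in the bounded set $L([0,1)^d)$.\<close>

lemma finite_representatives:
  fixes L :: "int^'d::finite^'d"
  assumes L: "expansion_matrix L" and F: "representatives L F"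
  shows "finite F"
proof -
  let ?M = "real_matrix L"
  \<comment> \<open>\<open>u k\<close> is the integer part of L^-1 k, so \<open>r k\<close> is L
    applied to the fractional part and stays in the residue class of \<open>k\<close>.\<close>
  define u where "u k = (\<chi> i. \<lfloor>(matrix_inv ?M *v real_vec k) $ i\<rfloor>)" for k :: "int^'d"
  define r where "r k = k - L *v u k" for k
  have "norm (real_vec (r k)) \<le> op_norm ?M * (\<Sum>i\<in>(UNIV :: 'd set). 1)" for k
  proof -
    let ?w = "matrix_inv ?M *v real_vec k - real_vec (u k)"
    have "real_vec (r k) = ?M *v ?w"
      using L by (simp add: r_def real_vec_diff real_vec_mult matrix_vector_mult_diff_distrib
          matrix_vector_mul_assoc matrix_inv_right expansion_matrix_def)
    then have "norm (real_vec (r k)) \<le> op_norm ?M * norm ?w"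
      by (metis op_norm_vec)
    also have "norm ?w \<le> (\<Sum>i\<in>UNIV. \<bar>?w $ i\<bar>)"
      by (rule norm_le_l1_cart)
    also have "\<dots> \<le> (\<Sum>i\<in>(UNIV :: 'd set). 1)"
      by (intro sum_mono) (simp add: u_def real_vec_def; linarith)
    finally show ?thesis
      using op_norm_nonneg mult_left_mono by blast
  qed
  then have "finite (r ` F)"
    by (intro finite_subset[OF _ finite_int_ball]) auto
  moreover have "inj_on r F"
  proof (rule inj_onI)
    fix f g assume fg: "f \<in> F" "g \<in> F" "r f = r g"
    then have "f - g = L *v (u f - u g)"
      by (simp add: r_def matrix_vector_mult_diff_distrib algebra_simps)
    then have "f - g \<in> range (\<lambda>j. L *v j)" by auto
    moreover have "f - f \<in> range (\<lambda>j. L *v j)"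
      by (auto simp: image_iff intro: exI[of _ 0])
    ultimately show "f = g"
      using F fg unfolding representatives_def by blast
  qed
  ultimately show ?thesis
    using finite_imageD by blast
qed

section \<open>Pointwise convergence of configurations\<close>

lemma eventually_sequentially_ex: "\<forall>\<^sub>F i in sequentially. P i \<Longrightarrow> \<exists>i. P i"
  using eventually_happens'[OF sequentially_bot] .

lemma shift_apply: "shift n x k = x (n + k)"
  by (simp add: shift_def)

lemma shift_shift [simp]: "shift m (shift n x) = shift (m + n) x"
  by (simp add: shift_def fun_eq_iff add.assoc add.left_commute)

lemma shift_0 [simp]: "shift 0 x = x"
  by (simp add: shift_def)

text \<open>For values in a discrete space, convergence means that each entry is eventually constant.\<close>

definition ptlim :: "(nat \<Rightarrow> 'i \<Rightarrow> 'a) \<Rightarrow> ('i \<Rightarrow> 'a) \<Rightarrow> bool" where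
  "ptlim x l \<longleftrightarrow> (\<forall>k. \<forall>\<^sub>F i in sequentially. x i k = l k)"

lemma ptlim_finite:
  assumes "ptlim x l" "finite P"
  shows "\<forall>\<^sub>F i in sequentially. \<forall>k\<in>P. x i k = l k"
  using assms by (simp add: ptlim_def eventually_ball_finite_distrib)

lemma ptlim_subseq: "ptlim x l \<Longrightarrow> strict_mono r \<Longrightarrow> ptlim (\<lambda>i. x (r i)) l"
  unfolding ptlim_def using eventually_subseq by blast

lemma ptlim_unique:
  assumes "ptlim x l" "ptlim x l'"
  shows "l = l'"
proof
  fix k
  have "\<forall>\<^sub>F i in sequentially. x i k = l k \<and> x i k = l' k"
    using assms by (simp add: ptlim_def eventually_conj)
  then show "l k = l' k"
    using eventually_sequentially_ex by fastforce
qed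

lemma ptlim_cong: "ptlim x l \<Longrightarrow> (\<And>k. \<forall>\<^sub>F i in sequentially. x i k = y i k) \<Longrightarrow> ptlim y l"
  unfolding ptlim_def
proof
  fix k
  assume "\<forall>k. \<forall>\<^sub>F i in sequentially. x i k = l k" and "\<And>k. \<forall>\<^sub>F i in sequentially. x i k = y i k"
  then have "\<forall>\<^sub>F i in sequentially. x i k = l k" "\<forall>\<^sub>F i in sequentially. x i k = y i k" by auto
  then show "\<forall>\<^sub>F i in sequentially. y i k = l k" by eventually_elim simp
qed

lemma ptlim_shift: "ptlim x l \<Longrightarrow> ptlim (\<lambda>i. shift k (x i)) (shift k l)"
  by (simp add: ptlim_def shift_def)

lemma ptlim_in:
  assumes "ptlim x l" "\<And>i k. x i k \<in> A"
  shows "l k \<in> A"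
proof -
  have "\<forall>\<^sub>F i in sequentially. x i k = l k"
    using assms by (simp add: ptlim_def)
  then obtain i where "x i k = l k"
    using eventually_sequentially_ex by blast
  then show ?thesis using assms(2)[of i k] by simp
qed

text \<open>An exhaustion by finite sets, playing the role of growing balls.\<close>

definition initial :: "nat \<Rightarrow> 'i::countable set" where
  "initial i = {k. to_nat k < i}"

lemma finite_initial [simp]: "finite (initial i)"
  unfolding initial_def by (rule finite_imageD[where f=to_nat]) (auto intro: finite_subset[of _ "{..<i}"])

lemma eventually_initial:
  assumes "finite P"
  shows "\<forall>\<^sub>F i in sequentially. P \<subseteq> initial i"
proof -
  have "\<forall>\<^sub>F i in sequentially. \<forall>k\<in>P. k \<in> initial i"
    using assms by (intro eventually_ball_finite) (auto simp: initial_def eventually_gt_at_top)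
  then show ?thesis by (simp add: subset_eq)
qed

lemma ptlim_initial:
  fixes x :: "nat \<Rightarrow> 'i::countable \<Rightarrow> 'a"
  assumes "\<And>i k. k \<in> initial i \<Longrightarrow> x i k = l k"
  shows "ptlim x l"
  unfolding ptlim_def
proof
  fix k :: 'i
  have "\<forall>\<^sub>F i in sequentially. {k} \<subseteq> initial i"
    by (rule eventually_initial) simp
  then show "\<forall>\<^sub>F i in sequentially. x i k = l k"
    by eventually_elim (auto intro: assms)
qed

lemma infinitely_often_constant:
  assumes "finite A" "\<And>i::nat. x i \<in> A"
  shows "\<exists>a\<in>A. \<exists>r :: nat \<Rightarrow> nat. strict_mono r \<and> (\<forall>i. x (r i) = a)"
proof -
  have "\<not> finite (UNIV :: nat set)" "finite (x ` UNIV)"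
    using assms by (auto intro: finite_subset)
  from pigeonhole_infinite[OF this] obtain i0 where "infinite {i. x i = x i0}"
    by auto
  from infinite_enumerate[OF this] obtain r :: "nat \<Rightarrow> nat"
    where "strict_mono r" "\<forall>i. x (r i) = x i0"
    by auto
  then show ?thesis
    using assms(2)[of i0] by blast
qed

text \<open>Sequential compactness by a diagonal argument: entry after entry is made constant along
  a further subsequence.\<close>

lemma ptlim_compact:
  fixes x :: "nat \<Rightarrow> 'i::countable \<Rightarrow> 'a"
  assumes "finite A" and x: "\<And>i k. x i k \<in> A"
  obtains r :: "nat \<Rightarrow> nat" and l where "strict_mono r" "ptlim (\<lambda>i. x (r i)) l"
proof -
  interpret subseqs "\<lambda>n s. \<exists>a. \<forall>i. x (s i) (from_nat n) = a"
  proof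
    fix n and s :: "nat \<Rightarrow> nat"
    obtain a r' where "strict_mono (r' :: nat \<Rightarrow> nat)" "\<forall>i. x (s (r' i)) (from_nat n) = a"
      using infinitely_often_constant[OF assms(1), of "\<lambda>i. x (s i) (from_nat n)"] x by blast
    then show "\<exists>r' :: nat \<Rightarrow> nat. strict_mono r' \<and> (\<exists>a. \<forall>i. x ((s \<circ> r') i) (from_nat n) = a)"
      by (intro exI[of _ r'] conjI exI[of _ a]) simp_all
  qed
  \<comment> \<open>From index \<open>Suc (to_nat k)\<close> on, the diagonal sequence runs inside
    the subsequence on which entry \<open>k\<close> is constant.\<close>
  define l where "l k = x (diagseq (Suc (to_nat k))) k" for k
  have *: "x (diagseq i) k = l k" if i: "i \<ge> Suc (to_nat k)" for i k
  proof -
    obtain a where a: "\<And>i. x (diagseq (Suc (to_nat k) + i)) k = a"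
      using diagseq_holds[of "to_nat k"] by fastforce
    show ?thesis
      using a[of "i - Suc (to_nat k)"] a[of 0] i by (simp add: l_def)
  qed
  have "ptlim (\<lambda>i. x (diagseq i)) l"
    unfolding ptlim_def eventually_sequentially using * by blast
  with subseq_diagseq show ?thesis ..
qed

text \<open>If no finite window sufficed, two sequences agreeing on ever larger windows would have a
  common limit along a subsequence, and continuity at it would equate their values of \<phi>. This
  serves both the factor map and the coding map built later.\<close>

lemma finite_window:
  fixes X :: "('i::countable \<Rightarrow> 'a) set"
  assumes A: "finite A" "\<And>x k. x \<in> X \<Longrightarrow> x k \<in> A"
    and closed: "\<And>x l. (\<And>i. x i \<in> X) \<Longrightarrow> ptlim x l \<Longrightarrow> l \<in> X"
    and cont: "\<And>x l. (\<And>i. x i \<in> X) \<Longrightarrow> l \<in> X \<Longrightarrow> ptlim x l \<Longrightarrow>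
      \<forall>\<^sub>F i in sequentially. \<phi> (x i) = \<phi> l"
  obtains D where "finite D" "\<And>x x'. x \<in> X \<Longrightarrow> x' \<in> X \<Longrightarrow> (\<And>k. k \<in> D \<Longrightarrow> x k = x' k) \<Longrightarrow> \<phi> x = \<phi> x'"
proof (rule ccontr)
  assume "\<not> thesis"
  with that have "\<exists>x x'. x \<in> X \<and> x' \<in> X \<and> (\<forall>k\<in>initial i. x k = x' k) \<and> \<phi> x \<noteq> \<phi> x'" for i
    by (metis finite_initial)
  then obtain x x' where x: "\<And>i. x i \<in> X" "\<And>i. x' i \<in> X"
    "\<And>i k. k \<in> initial i \<Longrightarrow> x i k = x' i k" "\<And>i. \<phi> (x i) \<noteq> \<phi> (x' i)"
    by metis
  obtain r l where r: "strict_mono r" "ptlim (\<lambda>i. x (r i)) l"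
    using ptlim_compact[OF A(1), of x] A(2) x(1) by blast
  have "ptlim (\<lambda>i. x' (r i)) l"
  proof (rule ptlim_cong[OF r(2)])
    fix k :: 'i
    have "\<forall>\<^sub>F i in sequentially. {k} \<subseteq> initial (r i)"
      using eventually_subseq[OF r(1) eventually_initial[of "{k}"]] by simp
    then show "\<forall>\<^sub>F i in sequentially. x (r i) k = x' (r i) k"
      by eventually_elim (auto intro: x)
  qed
  moreover have "l \<in> X"
    using closed[of "\<lambda>i. x (r i)"] x r by blast
  ultimately have "\<forall>\<^sub>F i in sequentially. \<phi> (x (r i)) = \<phi> l \<and> \<phi> (x' (r i)) = \<phi> l"
    using cont[of "\<lambda>i. x (r i)" l] cont[of "\<lambda>i. x' (r i)" l] x r by (simp add: eventually_conj)
  then obtain i where "\<phi> (x (r i)) = \<phi> l \<and> \<phi> (x' (r i)) = \<phi> l"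
    using eventually_sequentially_ex by blast
  then show False
    using x(4)[of "r i"] by simp
qed

section \<open>Cylinder sets and the product topology\<close>

lemma openin_config_cylinder:
  assumes "openin (config_topology A) U" "x \<in> U"
  obtains P where "finite P" "\<And>z. (\<And>k. z k \<in> A) \<Longrightarrow> (\<And>k. k \<in> P \<Longrightarrow> z k = x k) \<Longrightarrow> z \<in> U"
proof -
  obtain W where W: "finite {k. W k \<noteq> A}" "x \<in> Pi\<^sub>E UNIV W" "Pi\<^sub>E UNIV W \<subseteq> U"
    using assms unfolding config_topology_def openin_product_topology_alt
    by (auto simp: topspace_discrete_topology)
  show ?thesis
  proof (rule that[OF W(1)])
    fix z assume z: "\<And>k. z k \<in> A" "\<And>k. k \<in> {k. W k \<noteq> A} \<Longrightarrow> z k = x k"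
    have "z k \<in> W k" for k
      using z(1)[of k] z(2)[of k] W(2) by (cases "W k = A") auto
    then show "z \<in> U" using W(3) by auto
  qed
qed

lemma openin_cylinder:
  assumes "finite P"
  shows "openin (config_topology A) {z. (\<forall>k. z k \<in> A) \<and> (\<forall>k\<in>P. z k = x k)}"
proof -
  define W where "W k = (if k \<in> P then A \<inter> {x k} else A)" for k
  have "openin (config_topology A) (Pi\<^sub>E UNIV W)"
    unfolding config_topology_def
    by (rule product_topology_basis)
       (use assms in \<open>auto simp: W_def topspace_discrete_topology intro: finite_subset[of _ P]\<close>)
  moreover have "Pi\<^sub>E UNIV W = {z. (\<forall>k. z k \<in> A) \<and> (\<forall>k\<in>P. z k = x k)}"
    by (force simp: W_def PiE_iff split: if_splits)
  ultimately show ?thesis by simp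
qed

lemma continuous_map_config_ptlim:
  assumes cont: "continuous_map (subtopology (config_topology A) X) (subtopology (config_topology B) Y) \<tau>"
    and A: "\<And>x k. x \<in> X \<Longrightarrow> x k \<in> A"
    and x: "\<And>i. x i \<in> X" and l: "l \<in> X" and lim: "ptlim x l"
  shows "\<forall>\<^sub>F i in sequentially. \<tau> (x i) k = \<tau> l k"
proof -
  have "continuous_map (config_topology B) (discrete_topology B) (\<lambda>z. z k)"
    unfolding config_topology_def by (rule continuous_map_product_projection) simp
  then have "continuous_map (subtopology (config_topology A) X) (discrete_topology B) (\<lambda>z. \<tau> z k)"
    using continuous_map_compose[OF continuous_map_into_fulltopology[OF cont]] by (simp add: o_def)
  moreover have "\<tau> l k \<in> B"
    using continuous_map_image_subset_topspace[OF calculation] l A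
    by (auto simp: topspace_config_topology)
  ultimately have "openin (subtopology (config_topology A) X)
      {z \<in> topspace (subtopology (config_topology A) X). \<tau> z k \<in> {\<tau> l k}}"
    by (intro openin_continuous_map_preimage) auto
  then obtain U where U: "openin (config_topology A) U"
    "{z \<in> topspace (subtopology (config_topology A) X). \<tau> z k \<in> {\<tau> l k}} = U \<inter> X"
    unfolding openin_subtopology by blast
  have top: "topspace (subtopology (config_topology A) X) = X"
    using A by (auto simp: topspace_config_topology)
  then have "l \<in> U" using U(2) l by auto
  then obtain P where P: "finite P" "\<And>z. (\<And>k. z k \<in> A) \<Longrightarrow> (\<And>k. k \<in> P \<Longrightarrow> z k = l k) \<Longrightarrow> z \<in> U"
    using openin_config_cylinder[OF U(1)] by blast
  show ?thesis
    using ptlim_finite[OF lim P(1)]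
  proof eventually_elim
    case (elim i)
    then have "x i \<in> U \<inter> X" using P(2)[of "x i"] x A by auto
    then show ?case using U(2) by auto
  qed
qed


section \<open>Iterates of a constant-shape substitution\<close>

locale css =
  fixes A :: "'a set" and L :: "int^'d::finite^'d" and F :: "(int^'d) set"
    and \<zeta> :: "'a \<Rightarrow> int^'d \<Rightarrow> 'a"
  assumes css: "constant_shape_substitution A L F \<zeta>"
begin

abbreviation "Lp \<equiv> mat_pow L"
abbreviation "Fn \<equiv> iter_support L F"
abbreviation "sub \<equiv> subst_ext L F \<zeta>"
abbreviation "Z n \<equiv> sub ^^ n"
abbreviation "X \<equiv> subst_shift A L F \<zeta>"

lemma finite_A: "finite A" and A_nonempty: "A \<noteq> {}" and expansion: "expansion_matrix L"
  and reps: "representatives L F" and zero_in_F: "0 \<in> F" and foelner: "foelner Fn"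
  and \<zeta>_in: "a \<in> A \<Longrightarrow> f \<in> F \<Longrightarrow> \<zeta> a f \<in> A"
  using css by (auto simp: constant_shape_substitution_def)

lemma zero_in_Fn [simp]: "0 \<in> Fn n"
  by (induction n) (force simp: zero_in_F)+

lemma finite_F: "finite F"
  using finite_representatives[OF expansion reps] .

lemma finite_Fn [simp]: "finite (Fn n)"
proof (induction n)
  case (Suc n)
  have "Fn (Suc n) = (\<lambda>(f, g). f + L *v g) ` (F \<times> Fn n)" by auto
  then show ?case using Suc finite_F by simp
qed simp

lemma F_decomp: obtains j f where "f \<in> F" "k = L *v j + f"
proof -
  obtain f j where "f \<in> F" "k - f = L *v j"
    using reps unfolding representatives_def by blast
  then show ?thesis using that[of f j] by (simp add: algebra_simps)
qed

lemma F_unique: "f \<in> F \<Longrightarrow> f' \<in> F \<Longrightarrow> L *v j + f = L *v j' + f' \<Longrightarrow> j = j' \<and> f = f'"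
  using decomp_eq[OF expansion reps] by (metis prod.inject)

lemma Fn_Suc: "v \<in> Fn (Suc n) \<longleftrightarrow> (\<exists>f\<in>F. \<exists>g\<in>Fn n. v = L *v g + f)"
  by (auto simp: add.commute)

declare iter_support.simps(2) [simp del]

lemma Fn_decomp: obtains j f where "f \<in> Fn n" "k = Lp n *v j + f"
proof (induction n arbitrary: k thesis)
  case 0
  from 0[of 0 k] show ?case by simp
next
  case (Suc n)
  obtain j f where jf: "f \<in> F" "k = L *v j + f" by (rule F_decomp)
  obtain i g where ig: "g \<in> Fn n" "j = Lp n *v i + g" by (rule Suc(1))
  show ?case
    by (rule Suc(2)[of "L *v g + f" i])
       (use jf ig in \<open>auto simp: Fn_Suc mat_pow_Suc_vec matrix_vector_right_distrib\<close>)
qed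

lemma Fn_unique:
  "f \<in> Fn n \<Longrightarrow> f' \<in> Fn n \<Longrightarrow> Lp n *v j + f = Lp n *v j' + f' \<Longrightarrow> j = j' \<and> f = f'"
proof (induction n arbitrary: f f')
  case (Suc n)
  from Suc(2,3) obtain a b a' b' where ab: "a \<in> F" "b \<in> Fn n" "f = L *v b + a"
    "a' \<in> F" "b' \<in> Fn n" "f' = L *v b' + a'"
    unfolding Fn_Suc by blast
  then have "L *v (Lp n *v j + b) + a = L *v (Lp n *v j' + b') + a'"
    using Suc(4) by (simp add: mat_pow_Suc_vec matrix_vector_right_distrib add.assoc)
  with F_unique ab have "Lp n *v j + b = Lp n *v j' + b'" "a = a'" by blast+
  with Suc(1) ab show ?case by blast
qed simp

lemma representatives_Fn: "representatives (Lp n) (Fn n)"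
  unfolding representatives_def
proof
  fix k
  obtain j f where jf: "f \<in> Fn n" "k = Lp n *v j + f" by (rule Fn_decomp)
  show "\<exists>!f. f \<in> Fn n \<and> k - f \<in> range (\<lambda>j. Lp n *v j)"
  proof (rule ex1I[of _ f])
    show "f \<in> Fn n \<and> k - f \<in> range (\<lambda>j. Lp n *v j)" using jf by simp
  next
    fix f' assume f': "f' \<in> Fn n \<and> k - f' \<in> range (\<lambda>j. Lp n *v j)"
    then obtain j' where "k - f' = Lp n *v j'" by blast
    then have "k = Lp n *v j' + f'" by (simp add: algebra_simps)
    with jf f' Fn_unique show "f' = f" by metis
  qed
qed

lemma sub_eq: "f \<in> F \<Longrightarrow> sub x (L *v j + f) = \<zeta> (x j) f"
  using subst_ext_eq[OF css] .

lemma sub_in: "(\<And>k. x k \<in> A) \<Longrightarrow> sub x k \<in> A"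
  by (rule F_decomp[of k]) (simp add: sub_eq \<zeta>_in)

lemma Z_in: "(\<And>k. x k \<in> A) \<Longrightarrow> Z n x k \<in> A"
  by (induction n arbitrary: k) (simp_all add: sub_in)

lemma iter_subst_Z: "iter_subst L F \<zeta> n a = Z n (\<lambda>_. a)"
  by (induction n) simp_all

lemma Z_eq: "f \<in> Fn n \<Longrightarrow> Z n x (Lp n *v j + f) = iter_subst L F \<zeta> n (x j) f"
proof (induction n arbitrary: f)
  case (Suc n)
  then obtain a b where ab: "a \<in> F" "b \<in> Fn n" "f = L *v b + a"
    unfolding Fn_Suc by blast
  have "Lp (Suc n) *v j + f = L *v (Lp n *v j + b) + a"
    using ab by (simp add: mat_pow_Suc_vec matrix_vector_right_distrib add.assoc)
  then show ?case
    using ab Suc(1)[OF ab(2)] by (simp only: funpow.simps o_apply iter_subst.simps sub_eq)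
qed simp

text \<open>Later arguments only compare supertiles, so this replaces the explicit iterates.\<close>

lemma Z_cong:
  assumes "f \<in> Fn n" "x j = x' j'"
  shows "Z n x (Lp n *v j + f) = Z n x' (Lp n *v j' + f)"
  using assms by (simp add: Z_eq)

lemma shift_Z: "shift (Lp n *v k) (Z n x) = Z n (shift k x)"
proof
  fix t
  obtain j f where t: "f \<in> Fn n" "t = Lp n *v j + f" by (rule Fn_decomp)
  then have "shift (Lp n *v k) (Z n x) t = Z n x (Lp n *v (k + j) + f)"
    by (simp add: shift_def matrix_vector_right_distrib algebra_simps)
  also have "\<dots> = Z n (shift k x) (Lp n *v j + f)"
    using t by (intro Z_cong) (auto simp: shift_def)
  finally show "shift (Lp n *v k) (Z n x) t = Z n (shift k x) t"
    using t by simp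
qed

lemma Z_add: "Z (m + n) x = Z m (Z n x)"
  by (simp add: funpow_add)

lemma ptlim_Z:
  assumes "ptlim x l"
  shows "ptlim (\<lambda>i. Z n (x i)) (Z n l)"
  unfolding ptlim_def
proof
  fix k
  obtain j f where k: "f \<in> Fn n" "k = Lp n *v j + f" by (rule Fn_decomp)
  have "\<forall>\<^sub>F i in sequentially. x i j = l j"
    using assms by (simp add: ptlim_def)
  then show "\<forall>\<^sub>F i in sequentially. Z n (x i) k = Z n l k"
    using k by (auto elim!: eventually_mono intro: Z_cong)
qed

text \<open>Patterns can be taken at their place in \<^term>\<open>x\<close>, which avoids quantifying over them.\<close>

lemma in_X_iff:
  "x \<in> X \<longleftrightarrow> (\<forall>k. x k \<in> A) \<and>
    (\<forall>P. finite P \<longrightarrow> (\<exists>n>0. \<exists>a\<in>A. \<exists>q. \<forall>k\<in>P. q + k \<in> Fn n \<and> Z n (\<lambda>_. a) (q + k) = x k))"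
  (is "?l \<longleftrightarrow> ?r")
proof
  assume x: ?l
  show ?r
  proof (intro conjI allI impI)
    fix P :: "(int^'d) set" assume "finite P"
    moreover have "occurs_in P x UNIV x"
      unfolding occurs_in_def by (rule exI[of _ 0]) simp
    ultimately have "\<exists>n>0. \<exists>a\<in>A. occurs_in P x (Fn n) (iter_subst L F \<zeta> n a)"
      using x unfolding subst_shift_def by blast
    then show "\<exists>n>0. \<exists>a\<in>A. \<exists>q. \<forall>k\<in>P. q + k \<in> Fn n \<and> Z n (\<lambda>_. a) (q + k) = x k"
      by (simp add: occurs_in_def iter_subst_Z)
  qed (use x in \<open>simp add: subst_shift_def\<close>)
next
  assume x: ?r
  show ?l
    unfolding subst_shift_def
  proof (intro CollectI conjI allI impI)
    fix P w assume P: "finite P \<and> occurs_in P w UNIV x"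
    then obtain m where m: "\<And>k. k \<in> P \<Longrightarrow> x (m + k) = w k"
      unfolding occurs_in_def by auto
    have "finite ((+) m ` P)" using P by simp
    then obtain n a q where n: "n > 0" "a \<in> A"
      "\<forall>k\<in>(+) m ` P. q + k \<in> Fn n \<and> Z n (\<lambda>_. a) (q + k) = x k"
      using x by blast
    have "occurs_in P w (Fn n) (iter_subst L F \<zeta> n a)"
      unfolding occurs_in_def iter_subst_Z
      by (rule exI[of _ "q + m"]) (use n m in \<open>auto simp: add.assoc\<close>)
    with n show "\<exists>n>0. \<exists>a\<in>A. occurs_in P w (Fn n) (iter_subst L F \<zeta> n a)"
      by blast
  qed (use x in simp)
qed

lemma X_in: "x \<in> X \<Longrightarrow> x k \<in> A"
  by (simp add: in_X_iff)

lemma X_shift: "x \<in> X \<Longrightarrow> shift m x \<in> X"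
  unfolding in_X_iff
proof (intro conjI allI impI)
  fix P :: "(int^'d) set" assume x: "(\<forall>k. x k \<in> A) \<and>
    (\<forall>P. finite P \<longrightarrow> (\<exists>n>0. \<exists>a\<in>A. \<exists>q. \<forall>k\<in>P. q + k \<in> Fn n \<and> Z n (\<lambda>_. a) (q + k) = x k))"
    and "finite P"
  then obtain n a q where n: "n > 0" "a \<in> A"
      "\<forall>k\<in>(+) m ` P. q + k \<in> Fn n \<and> Z n (\<lambda>_. a) (q + k) = x k"
    by (metis finite_imageI)
  then show "\<exists>n>0. \<exists>a\<in>A. \<exists>q. \<forall>k\<in>P. q + k \<in> Fn n \<and> Z n (\<lambda>_. a) (q + k) = shift m x k"
    by (intro exI[of _ n] conjI bexI[of _ a] exI[of _ "q + m"]) (auto simp: shift_def add.assoc)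
qed (simp add: shift_def)

lemma X_locally:
  assumes "\<And>k. x k \<in> A" "\<And>P. finite P \<Longrightarrow> \<exists>y\<in>X. \<forall>k\<in>P. y k = x k"
  shows "x \<in> X"
  unfolding in_X_iff
proof (intro conjI allI impI)
  fix P :: "(int^'d) set" assume P: "finite P"
  then obtain y where y: "y \<in> X" "\<forall>k\<in>P. y k = x k"
    using assms(2) by blast
  then obtain n a q where "n > 0" "a \<in> A" "\<forall>k\<in>P. q + k \<in> Fn n \<and> Z n (\<lambda>_. a) (q + k) = y k"
    using P unfolding in_X_iff by blast
  with y(2) show "\<exists>n>0. \<exists>a\<in>A. \<exists>q. \<forall>k\<in>P. q + k \<in> Fn n \<and> Z n (\<lambda>_. a) (q + k) = x k"
    by (metis (no_types, lifting))
qed (rule assms(1))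

lemma X_ptlim:
  assumes "\<And>i. x i \<in> X" "ptlim x l"
  shows "l \<in> X"
proof (rule X_locally)
  show "l k \<in> A" for k
    using ptlim_in[OF assms(2)] assms(1) X_in by blast
next
  fix P :: "(int^'d) set" assume "finite P"
  then show "\<exists>y\<in>X. \<forall>k\<in>P. y k = l k"
    using eventually_happens'[OF sequentially_bot ptlim_finite[OF assms(2)]] assms(1) by metis
qed

text \<open>Applied later to the new substitution, where it gives the compactness that makes the
  inverse of the letter map continuous.\<close>

lemma closedin_X: "closedin (config_topology A) X"
  unfolding closedin_def
proof (intro conjI)
  show "X \<subseteq> topspace (config_topology A)"
    by (auto simp: topspace_config_topology X_in)
  show "openin (config_topology A) (topspace (config_topology A) - X)"
  proof (subst openin_subopen, intro ballI)
    fix x assume x: "x \<in> topspace (config_topology A) - X"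
    then have "\<exists>P. finite P \<and> \<not> (\<exists>y\<in>X. \<forall>k\<in>P. y k = x k)"
      using X_locally[of x] by (simp add: topspace_config_topology) blast
    then obtain P where P: "finite P" "\<not> (\<exists>y\<in>X. \<forall>k\<in>P. y k = x k)" by blast
    then show "\<exists>T. openin (config_topology A) T \<and> x \<in> T \<and> T \<subseteq> topspace (config_topology A) - X"
      using x openin_cylinder[OF P(1), of A x]
      by (intro exI[of _ "{z. (\<forall>k. z k \<in> A) \<and> (\<forall>k\<in>P. z k = x k)}"])
         (auto simp: topspace_config_topology)
  qed
qed

lemma shift_sub: "shift (L *v k) (sub x) = sub (shift k x)"
  using shift_Z[of 1 k x] by (simp add: mat_pow.simps)

lemma Z_const: "f \<in> Fn n \<Longrightarrow> Z n u f = Z n (\<lambda>_. u 0) f"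
  using Z_cong[of f n u 0 "\<lambda>_. u 0" 0] by simp

lemma sub_X:
  assumes "x \<in> X"
  shows "sub x \<in> X"
  unfolding in_X_iff
proof (intro conjI allI impI)
  show "sub x k \<in> A" for k
    using assms by (intro sub_in X_in)
next
  fix P :: "(int^'d) set" assume P: "finite P"
  \<comment> \<open>\<open>Q\<close> indexes the supertiles that meet \<open>P\<close>; an
    occurrence of \<open>x\<close> on \<open>Q\<close> at offset q yields one of
    \<open>sub x\<close> on \<open>P\<close> at offset L q.\<close>
  define Q where "Q = fst ` decomp L F ` P"
  have Q: "j \<in> Q" if "L *v j + f \<in> P" "f \<in> F" for j f
    using that decomp_eq[OF expansion reps, of f j] by (force simp: Q_def image_iff)
  have "finite Q" using P by (simp add: Q_def)
  then obtain n a q where n: "n > 0" "a \<in> A" "\<forall>k\<in>Q. q + k \<in> Fn n \<and> Z n (\<lambda>_. a) (q + k) = x k"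
    using assms unfolding in_X_iff by blast
  have "L *v q + k \<in> Fn (Suc n) \<and> Z (Suc n) (\<lambda>_. a) (L *v q + k) = sub x k" if k: "k \<in> P" for k
  proof -
    obtain j f where jf: "f \<in> F" "k = L *v j + f" by (rule F_decomp)
    then have j: "q + j \<in> Fn n" "Z n (\<lambda>_. a) (q + j) = x j"
      using Q[of j f] n k by auto
    have eq: "L *v q + k = L *v (q + j) + f"
      using jf by (simp add: matrix_vector_right_distrib add.assoc)
    have "L *v q + k \<in> Fn (Suc n)"
      unfolding eq Fn_Suc using j jf by blast
    moreover have "Z (Suc n) (\<lambda>_. a) (L *v q + k) = sub x k"
      unfolding eq using j(2) by (simp only: funpow.simps o_apply sub_eq[OF jf(1)] jf(2))
    ultimately show ?thesis ..
  qed
  then show "\<exists>n>0. \<exists>a\<in>A. \<exists>q. \<forall>k\<in>P. q + k \<in> Fn n \<and> Z n (\<lambda>_. a) (q + k) = sub x k"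
    using n(2) by (intro exI[of _ "Suc n"] conjI bexI[of _ a] exI[of _ "L *v q"]) auto
qed

lemma Z_X: "x \<in> X \<Longrightarrow> Z n x \<in> X"
  by (induction n) (simp_all add: sub_X)

text \<open>A point q of F_n with q + k outside F_n lies in the symmetric difference of F_n and -k +
  F_n. For large n each of these has fewer than |F_n| / (|P| + 1) points, so together they do not
  cover F_n.\<close>

lemma Fn_contains_translate:
  assumes "finite P"
  obtains n q where "n > 0" "\<And>k. k \<in> P \<Longrightarrow> q + k \<in> Fn n"
proof -
  define c where "c = real (card P + 1)"
  let ?s = "\<lambda>k n. card (sym_diff (Fn n) ((\<lambda>v. - k + v) ` Fn n))"
  have "\<forall>\<^sub>F n in sequentially. real (?s k n) / real (card (Fn n)) < 1 / c" for k
    by (rule order_tendstoD(2)[OF foelner[unfolded foelner_def, rule_format, of "- k"]]) (simp add: c_def)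
  then have "\<forall>\<^sub>F n in sequentially. n > 0 \<and> (\<forall>k\<in>P. real (?s k n) / real (card (Fn n)) < 1 / c)"
    using assms by (intro eventually_conj eventually_gt_at_top eventually_ball_finite) auto
  then obtain n where n: "n > 0" "\<And>k. k \<in> P \<Longrightarrow> real (?s k n) / real (card (Fn n)) < 1 / c"
    using eventually_sequentially_ex by blast
  have pos: "card (Fn n) > 0"
    by (metis card_gt_0_iff emptyE finite_Fn zero_in_Fn)
  have "\<exists>q\<in>Fn n. \<forall>k\<in>P. q + k \<in> Fn n"
  proof (rule ccontr)
    assume "\<not> ?thesis"
    then have "Fn n \<subseteq> (\<Union>k\<in>P. sym_diff (Fn n) ((\<lambda>v. - k + v) ` Fn n))"
      by force
    then have "card (Fn n) \<le> card (\<Union>k\<in>P. sym_diff (Fn n) ((\<lambda>v. - k + v) ` Fn n))"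
      using assms by (intro card_mono) auto
    also have "\<dots> \<le> (\<Sum>k\<in>P. ?s k n)"
      by (rule card_UN_le[OF assms])
    finally have "real (card (Fn n)) \<le> (\<Sum>k\<in>P. real (?s k n))"
      by (simp flip: of_nat_sum)
    also have "\<dots> \<le> (\<Sum>k\<in>P. real (card (Fn n)) / c)"
      using n(2) pos by (intro sum_mono) (auto simp: field_simps c_def intro!: less_imp_le)
    also have "\<dots> < real (card (Fn n))"
      using pos by (simp add: c_def field_simps)
    finally show False by simp
  qed
  then show ?thesis
    using that n(1) by blast
qed

text \<open>A limit of translates of \<zeta>^n(a) whose supports contain growing windows.\<close>

lemma X_nonempty: "X \<noteq> {}"
proof -
  obtain a where a: "a \<in> A" using A_nonempty by blast
  have "\<exists>n q. n > 0 \<and> (\<forall>k\<in>initial i. q + k \<in> Fn n)" for i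
    using Fn_contains_translate[of "initial i"] finite_initial by (metis (no_types))
  then obtain n q where nq: "\<And>i. n i > 0" "\<And>i k. k \<in> initial i \<Longrightarrow> q i + k \<in> Fn (n i)"
    by metis
  define x where "x i = shift (q i) (Z (n i) (\<lambda>_. a))" for i
  have x_in: "x i k \<in> A" for i k
    unfolding x_def shift_def using a by (intro Z_in)
  obtain r l where r: "strict_mono r" "ptlim (\<lambda>i. x (r i)) l"
    using ptlim_compact[OF finite_A, of x] x_in by blast
  have "l \<in> X"
    unfolding in_X_iff
  proof (intro conjI allI impI)
    show "l k \<in> A" for k
      using ptlim_in[OF r(2)] x_in by blast
  next
    fix P :: "(int^'d) set" assume P: "finite P"
    have "\<forall>\<^sub>F i in sequentially. P \<subseteq> initial (r i) \<and> (\<forall>k\<in>P. x (r i) k = l k)"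
      using eventually_subseq[OF r(1) eventually_initial[OF P]] ptlim_finite[OF r(2) P]
      by (rule eventually_conj)
    then obtain i where "P \<subseteq> initial (r i)" "\<forall>k\<in>P. x (r i) k = l k"
      using eventually_sequentially_ex by blast
    then show "\<exists>n>0. \<exists>a\<in>A. \<exists>q. \<forall>k\<in>P. q + k \<in> Fn n \<and> Z n (\<lambda>_. a) (q + k) = l k"
      using nq a by (intro exI[of _ "n (r i)"] conjI bexI[of _ a] exI[of _ "q (r i)"])
        (auto simp: x_def shift_def)
  qed
  then show ?thesis by blast
qed

text \<open>A large ball is stable, since $L^{-1}$ is a contraction.\<close>

lemma stable_window:
  assumes "finite D\<^sub>0"
  obtains D where "finite D" "D\<^sub>0 \<subseteq> D"
    "\<And>n f f' f'' d. f \<in> Fn n \<Longrightarrow> f' \<in> Fn n \<Longrightarrow> f'' \<in> Fn n \<Longrightarrow> d \<in> D \<Longrightarrow>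
      \<exists>e\<in>D. \<exists>g\<in>Fn n. f + f' - f'' + d = Lp n *v e + g"
proof -
  define c where "c = op_norm (matrix_inv (real_matrix L))"
  have c: "0 \<le> c" "c < 1"
    using expansion by (auto simp: c_def op_norm_nonneg expansion_matrix_def)
  define b where "b = (\<Sum>f\<in>F. norm (real_vec f))"
  have b: "norm (real_vec f) \<le> b" if "f \<in> F" for f
    unfolding b_def using that finite_F by (intro member_le_sum) auto
  \<comment> \<open>R must satisfy c (4 b + R) \<le> R; the four terms b bound the three digits and
    the remainder of the division by L.\<close>
  define R where "R = max (\<Sum>d\<in>D\<^sub>0. norm (real_vec d)) (4 * b * c / (1 - c))"
  define D where "D = {v :: int^'d. norm (real_vec v) \<le> R}"
  have R: "c * (4 * b + R) \<le> R"
  proof -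
    have "4 * b * c / (1 - c) \<le> R" by (simp add: R_def)
    then have "4 * b * c \<le> R * (1 - c)" using c by (simp add: field_simps)
    then show ?thesis by (simp add: algebra_simps)
  qed
  have "norm (real_vec d) \<le> R" if "d \<in> D\<^sub>0" for d
  proof -
    have "norm (real_vec d) \<le> (\<Sum>d\<in>D\<^sub>0. norm (real_vec d))"
      using that assms by (intro member_le_sum) auto
    then show ?thesis by (simp add: R_def)
  qed
  then have D0: "D\<^sub>0 \<subseteq> D" by (auto simp: D_def)
  \<comment> \<open>The combination f + f' - f'' covers both uses: points of a supertile seen
    through the window, and such points moved by a difference of two phases.\<close>
  have step: "\<exists>e\<in>D. \<exists>g\<in>F. f + f' - f'' + d = L *v e + g"
    if f: "f \<in> F" "f' \<in> F" "f'' \<in> F" "d \<in> D" for f f' f'' d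
  proof -
    obtain e g where eg: "g \<in> F" "f + f' - f'' + d = L *v e + g" by (rule F_decomp)
    then have "L *v e = f + f' - f'' - g + d" by (simp add: algebra_simps)
    then have "norm (real_vec (L *v e)) = norm (real_vec f + real_vec f' - real_vec f'' - real_vec g + real_vec d)"
      by (simp add: real_vec_add real_vec_diff)
    also have "\<dots> \<le> norm (real_vec f) + norm (real_vec f') + norm (real_vec f'') + norm (real_vec g) + norm (real_vec d)"
      using norm_triangle_ineq[of "real_vec f + real_vec f' - real_vec f'' - real_vec g" "real_vec d"]
        norm_triangle_ineq4[of "real_vec f + real_vec f' - real_vec f''" "real_vec g"]
        norm_triangle_ineq4[of "real_vec f + real_vec f'" "real_vec f''"]
        norm_triangle_ineq[of "real_vec f" "real_vec f'"] by linarith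
    also have "\<dots> \<le> 4 * b + R"
      using b[OF f(1)] b[OF f(2)] b[OF f(3)] b[OF eg(1)] f(4) by (simp add: D_def)
    finally have "c * norm (real_vec (L *v e)) \<le> c * (4 * b + R)"
      using c by (intro mult_left_mono) auto
    moreover have "norm (real_vec e) \<le> c * norm (real_vec (L *v e))"
      unfolding c_def by (rule expansion_matrix_norm[OF expansion])
    ultimately have "e \<in> D" using R by (simp add: D_def)
    with eg show ?thesis by blast
  qed
  show ?thesis
  proof (rule that[OF _ D0])
    show "finite D" unfolding D_def by (rule finite_int_ball)
  next
    show "\<exists>e\<in>D. \<exists>g\<in>Fn n. f + f' - f'' + d = Lp n *v e + g"
      if "f \<in> Fn n" "f' \<in> Fn n" "f'' \<in> Fn n" "d \<in> D" for n f f' f'' d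
      using that
    proof (induction n arbitrary: f f' f'' d)
      case 0
      then show ?case by auto
    next
      case (Suc n)
      from Suc(2,3,4) obtain a b a' b' a'' b'' where ab:
        "a \<in> F" "b \<in> Fn n" "f = L *v b + a" "a' \<in> F" "b' \<in> Fn n" "f' = L *v b' + a'"
        "a'' \<in> F" "b'' \<in> Fn n" "f'' = L *v b'' + a''"
        unfolding Fn_Suc by blast
      obtain e g where eg: "e \<in> D" "g \<in> F" "a + a' - a'' + d = L *v e + g"
        using step[OF ab(1,4,7) Suc(5)] by blast
      \<comment> \<open>The carry \<open>e\<close> of the lowest digits is again in
        \<open>D\<close>, so it takes the place of \<open>d\<close> for the higher digits.\<close>
      obtain e' g' where eg': "e' \<in> D" "g' \<in> Fn n" "b + b' - b'' + e = Lp n *v e' + g'"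
        using Suc(1)[OF ab(2,5,8) eg(1)] by blast
      have "f + f' - f'' + d = L *v (b + b' - b'') + (a + a' - a'' + d)"
        using ab by (simp add: matrix_vector_right_distrib matrix_vector_mult_diff_distrib)
      also have "\<dots> = L *v (b + b' - b'' + e) + g"
        using eg by (simp add: matrix_vector_right_distrib add.assoc)
      also have "\<dots> = Lp (Suc n) *v e' + (L *v g' + g)"
        using eg' by (simp add: matrix_vector_right_distrib mat_pow_Suc_vec add.assoc)
      finally show ?case
        using eg eg' Fn_Suc by blast
    qed
  qed
qed

end


section \<open>Primitive substitutions\<close>

locale primitive_css = css A L F \<zeta>
  for A :: "'a set" and L :: "int^'d::finite^'d" and F :: "(int^'d) set"
    and \<zeta> :: "'a \<Rightarrow> int^'d \<Rightarrow> 'a" +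
  assumes prim: "primitive_subst A L F \<zeta>"
begin

text \<open>Beyond level N, apply \<zeta>^N to the letter of \<zeta>^k(a) at 0.\<close>

lemma primitive_eventually:
  obtains N where "\<forall>n\<ge>N. \<forall>a\<in>A. \<forall>b\<in>A. \<exists>f\<in>Fn n. Z n (\<lambda>_. a) f = b"
proof -
  obtain N where N: "\<And>a b. a \<in> A \<Longrightarrow> b \<in> A \<Longrightarrow> \<exists>f\<in>Fn N. Z N (\<lambda>_. a) f = b"
    using prim unfolding primitive_subst_def iter_subst_Z by blast
  have "\<exists>f\<in>Fn n. Z n (\<lambda>_. a) f = b" if n: "n \<ge> N" and "a \<in> A" "b \<in> A" for n a b
  proof -
    obtain k where k: "n = N + k" using le_Suc_ex[OF n] by auto
    have "Z k (\<lambda>_. a) 0 \<in> A" using \<open>a \<in> A\<close> by (intro Z_in)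
    then obtain f where f: "f \<in> Fn N" "Z N (\<lambda>_. Z k (\<lambda>_. a) 0) f = b"
      using N \<open>b \<in> A\<close> by blast
    have "f \<in> Fn n"
      unfolding k iter_support_add using f(1) by (intro CollectI exI[of _ f] exI[of _ 0]) simp
    moreover have "Z n (\<lambda>_. a) f = b"
      using f Z_const[of f N "Z k (\<lambda>_. a)"] by (simp add: k Z_add)
    ultimately show ?thesis by blast
  qed
  then show ?thesis using that by blast
qed

text \<open>The pattern occurs in some \<zeta>^m(a), and \<open>a\<close> occurs in \<zeta>^k(b) for
  all large k, so \<zeta>^(m+k)(b) contains a copy of \<zeta>^m(a). This is the source of
  minimality.\<close>

lemma pattern_occurs_eventually:
  assumes "x \<in> X" "finite P"
  obtains N where "\<forall>n\<ge>N. \<forall>b\<in>A. \<exists>q. \<forall>k\<in>P. q + k \<in> Fn n \<and> Z n (\<lambda>_. b) (q + k) = x k"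
proof -
  obtain M where M: "\<forall>n\<ge>M. \<forall>a\<in>A. \<forall>b\<in>A. \<exists>f\<in>Fn n. Z n (\<lambda>_. a) f = b"
    by (rule primitive_eventually)
  obtain m a q where m: "a \<in> A" "\<forall>k\<in>P. q + k \<in> Fn m \<and> Z m (\<lambda>_. a) (q + k) = x k"
    using assms unfolding in_X_iff by blast
  have "\<exists>q. \<forall>k\<in>P. q + k \<in> Fn n \<and> Z n (\<lambda>_. b) (q + k) = x k" if n: "n \<ge> m + M" and b: "b \<in> A" for n b
  proof -
    obtain k where k: "n = m + k" using n le_Suc_ex[of m n] by auto
    with n have "k \<ge> M" by simp
    with M b m(1) obtain f where f: "f \<in> Fn k" "Z k (\<lambda>_. b) f = a"
      by blast
    have "Lp m *v f + q + t \<in> Fn n \<and> Z n (\<lambda>_. b) (Lp m *v f + q + t) = x t" if t: "t \<in> P" for t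
    proof -
      have qt: "q + t \<in> Fn m" using m t by blast
      then have "Lp m *v f + q + t \<in> Fn n"
        unfolding k iter_support_add using f
        by (intro CollectI exI[of _ "q + t"] exI[of _ f]) (simp add: algebra_simps)
      moreover have "Z n (\<lambda>_. b) (Lp m *v f + (q + t)) = Z m (\<lambda>_. a) (Lp m *v 0 + (q + t))"
        unfolding k Z_add by (rule Z_cong) (use qt f in auto)
      ultimately show ?thesis using m t by (simp add: add.assoc)
    qed
    then show ?thesis by blast
  qed
  then show ?thesis using that by blast
qed

text \<open>Windows of \<open>x\<close> occur in iterates of one letter, which have obvious
  desubstitutions. The phases take finitely many values, so along a subsequence the phase is
  constant and the desubstitutions converge.\<close>

lemma desubstitute_sub:
  assumes x: "x \<in> X"
  obtains f u where "f \<in> F" "u \<in> X" "x = shift f (sub u)"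
proof -
  obtain b where b: "b \<in> A" using A_nonempty by blast
  have "\<exists>n j f. n > 0 \<and> f \<in> F \<and>
    (\<forall>k\<in>initial i. L *v j + f + k \<in> Fn (Suc n) \<and> Z (Suc n) (\<lambda>_. b) (L *v j + f + k) = x k)" for i
  proof -
    obtain N where "\<forall>n\<ge>N. \<forall>b\<in>A. \<exists>q. \<forall>k\<in>initial i. q + k \<in> Fn n \<and> Z n (\<lambda>_. b) (q + k) = x k"
      using pattern_occurs_eventually[OF x finite_initial] .
    \<comment> \<open>One application is peeled off, and the definition of \<open>X\<close> asks for
      a positive exponent; hence two successors.\<close>
    then obtain q where q: "\<forall>k\<in>initial i. q + k \<in> Fn (Suc (Suc N)) \<and> Z (Suc (Suc N)) (\<lambda>_. b) (q + k) = x k"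
      using b by (metis le_SucI order_refl)
    obtain j f where "f \<in> F" "q = L *v j + f" by (rule F_decomp)
    with q show ?thesis by (intro exI[of _ "Suc N"] exI[of _ j] exI[of _ f]) auto
  qed
  then obtain n j f where n: "\<And>i. n i > 0" and f: "\<And>i. f i \<in> F"
    and occ: "\<And>i k. k \<in> initial i \<Longrightarrow> L *v j i + f i + k \<in> Fn (Suc (n i)) \<and>
      Z (Suc (n i)) (\<lambda>_. b) (L *v j i + f i + k) = x k"
    by metis
  define u where "u i = shift (j i) (Z (n i) (\<lambda>_. b))" for i
  have u_in: "u i k \<in> A" for i k
    unfolding u_def shift_def using b by (intro Z_in)
  obtain g and r\<^sub>1 :: "nat \<Rightarrow> nat" where g: "g \<in> F" and r1: "strict_mono r\<^sub>1" "\<And>i. f (r\<^sub>1 i) = g"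
    using infinitely_often_constant[of F f, OF finite_F f] by auto
  obtain r\<^sub>2 l where r2: "strict_mono r\<^sub>2" "ptlim (\<lambda>i. u (r\<^sub>1 (r\<^sub>2 i))) l"
    using ptlim_compact[OF finite_A, of "\<lambda>i. u (r\<^sub>1 i)"] u_in by blast
  define r where "r i = r\<^sub>1 (r\<^sub>2 i)" for i
  have r: "strict_mono r" "\<And>i. f (r i) = g" "ptlim (\<lambda>i. u (r i)) l"
    using strict_mono_o[OF r1(1) r2(1)] r1 r2 by (auto simp: r_def[abs_def] o_def)
  have "shift (f i) (sub (u i)) k = x k" if "k \<in> initial i" for i k
  proof -
    have "sub (u i) = shift (L *v j i) (Z (Suc (n i)) (\<lambda>_. b))"
      by (simp add: u_def shift_sub)
    then have "shift (f i) (sub (u i)) k = Z (Suc (n i)) (\<lambda>_. b) (L *v j i + f i + k)"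
      by (simp only: shift_def add.assoc)
    then show ?thesis using occ[OF that] by simp
  qed
  then have "ptlim (\<lambda>i. shift (f i) (sub (u i))) x"
    by (rule ptlim_initial)
  from ptlim_subseq[OF this r(1)] have "ptlim (\<lambda>i. shift g (sub (u (r i)))) x"
    using r(2) by simp
  moreover have "ptlim (\<lambda>i. shift g (sub (u (r i)))) (shift g (sub l))"
    using ptlim_shift[OF ptlim_Z[OF r(3), of 1]] by simp
  ultimately have "x = shift g (sub l)"
    by (rule ptlim_unique)
  moreover have "l \<in> X"
    unfolding in_X_iff
  proof (intro conjI allI impI)
    show "l k \<in> A" for k
      using ptlim_in[OF r(3)] u_in by blast
  next
    fix P :: "(int^'d) set" assume P: "finite P"
    \<comment> \<open>In \<open>shift g (sub l)\<close> the position L k - g is the base point of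
      the supertile of letter k. If it lies in the window, k is in the support of the desubstituted
      pattern.\<close>
    have "finite ((\<lambda>k. L *v k - g) ` P)" using P by simp
    then have "\<forall>\<^sub>F i in sequentially. (\<lambda>k. L *v k - g) ` P \<subseteq> initial (r i) \<and> (\<forall>k\<in>P. u (r i) k = l k)"
      by (intro eventually_conj eventually_subseq[OF r(1)] eventually_initial ptlim_finite[OF r(3) P])
    then obtain i where i: "(\<lambda>k. L *v k - g) ` P \<subseteq> initial (r i)" "\<forall>k\<in>P. u (r i) k = l k"
      using eventually_sequentially_ex by blast
    have "j (r i) + k \<in> Fn (n (r i))" if "k \<in> P" for k
    proof -
      have "L *v j (r i) + g + (L *v k - g) \<in> Fn (Suc (n (r i)))"
        using occ[of "L *v k - g" "r i"] i(1) that r(2) by auto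
      then have "L *v (j (r i) + k) + 0 \<in> Fn (Suc (n (r i)))"
        by (simp add: matrix_vector_right_distrib)
      then show ?thesis
        unfolding Fn_Suc using F_unique[OF zero_in_F] by metis
    qed
    then show "\<exists>n>0. \<exists>a\<in>A. \<exists>q. \<forall>k\<in>P. q + k \<in> Fn n \<and> Z n (\<lambda>_. a) (q + k) = l k"
      using n b i(2) by (intro exI[of _ "n (r i)"] conjI bexI[of _ b] exI[of _ "j (r i)"])
        (auto simp: u_def shift_def)
  qed
  ultimately show ?thesis using g that by blast
qed

lemma desubstitute:
  assumes "x \<in> X"
  obtains f u where "f \<in> Fn n" "u \<in> X" "x = shift f (Z n u)"
  using assms
proof (induction n arbitrary: x thesis)
  case 0
  from 0(1)[of 0 x] 0(2) show ?case by simp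
next
  case (Suc n)
  obtain f u where u: "f \<in> F" "u \<in> X" "x = shift f (sub u)"
    using desubstitute_sub[OF Suc(3)] .
  obtain g v where v: "g \<in> Fn n" "v \<in> X" "u = shift g (Z n v)"
    using Suc(1)[OF _ u(2)] by blast
  have "x = shift (L *v g + f) (Z (Suc n) v)"
    using u v by (simp add: shift_sub[symmetric] add.commute)
  with v u show ?case
    by (intro Suc(2)[of "L *v g + f" v]) (auto simp: Fn_Suc)
qed

text \<open>Only finitely many patterns on \<open>D\<close> exist, so at one common level every
  supertile contains all of them, and every point is tiled by such supertiles.\<close>

lemma uniformly_recurrent:
  assumes D: "finite D"
  obtains V where "finite V" "\<And>x x'. x \<in> X \<Longrightarrow> x' \<in> X \<Longrightarrow> \<exists>v\<in>V. \<forall>d\<in>D. x (v + d) = x' d"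
proof -
  define W where "W = (\<lambda>x. restrict x D) ` X"
  have "W \<subseteq> PiE D (\<lambda>_. A)" by (auto simp: W_def X_in)
  then have W: "finite W"
    using finite_PiE[OF D] finite_A by (meson finite_subset)
  have "\<forall>w\<in>W. \<exists>N. \<forall>n\<ge>N. \<forall>b\<in>A. \<exists>q. \<forall>k\<in>D. q + k \<in> Fn n \<and> Z n (\<lambda>_. b) (q + k) = w k"
  proof
    fix w assume "w \<in> W"
    then obtain x where x: "x \<in> X" "w = restrict x D" by (auto simp: W_def)
    obtain N where "\<forall>n\<ge>N. \<forall>b\<in>A. \<exists>q. \<forall>k\<in>D. q + k \<in> Fn n \<and> Z n (\<lambda>_. b) (q + k) = x k"
      using pattern_occurs_eventually[OF x(1) D] .
    then show "\<exists>N. \<forall>n\<ge>N. \<forall>b\<in>A. \<exists>q. \<forall>k\<in>D. q + k \<in> Fn n \<and> Z n (\<lambda>_. b) (q + k) = w k"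
      by (intro exI[of _ N]) (simp add: x(2))
  qed
  from bchoice[OF this] obtain N where N: "\<forall>w\<in>W. \<forall>n\<ge>N w. \<forall>b\<in>A.
      \<exists>q. \<forall>k\<in>D. q + k \<in> Fn n \<and> Z n (\<lambda>_. b) (q + k) = w k" ..
  define M where "M = (\<Sum>w\<in>W. N w)"
  \<comment> \<open>Offsets q - f, where f is the phase of the tile and q = g - d places some d at a
    point g of the tile; 0 is for empty \<open>D\<close>.\<close>
  define V where "V = insert 0 ((\<lambda>(g, d, f). g - d - f) ` (Fn M \<times> D \<times> Fn M))"
  show ?thesis
  proof (rule that)
    show "finite V" using D by (simp add: V_def)
  next
    fix x x' assume x: "x \<in> X" "x' \<in> X"
    obtain f u where u: "f \<in> Fn M" "u \<in> X" "x = shift f (Z M u)"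
      using desubstitute[OF x(1)] .
    have xw: "restrict x' D \<in> W" using x by (auto simp: W_def)
    then have "N (restrict x' D) \<le> M"
      unfolding M_def using W xw by (intro member_le_sum) blast+
    then have "\<exists>q. \<forall>k\<in>D. q + k \<in> Fn M \<and> Z M (\<lambda>_. u 0) (q + k) = restrict x' D k"
      using N xw X_in[OF u(2)] by blast
    then obtain q where q: "\<And>k. k \<in> D \<Longrightarrow> q + k \<in> Fn M" "\<And>k. k \<in> D \<Longrightarrow> Z M (\<lambda>_. u 0) (q + k) = x' k"
      by auto
    show "\<exists>v\<in>V. \<forall>d\<in>D. x (v + d) = x' d"
    proof (cases "D = {}")
      case True
      then show ?thesis by (auto simp: V_def)
    next
      case False
      then obtain d where d: "d \<in> D" by blast
      have "(q + d) - d - f \<in> V"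
        unfolding V_def using q(1)[OF d] d u(1)
        by (intro insertI2 image_eqI[of _ _ "(q + d, d, f)"]) auto
      moreover have "x (q - f + k) = x' k" if "k \<in> D" for k
        using q[OF that] Z_const[of "q + k" M u] by (simp add: u(3) shift_def)
      ultimately show ?thesis by (intro bexI[of _ "q - f"]) auto
    qed
  qed
qed

end

section \<open>Divisibility along the powers of a matrix\<close>

lemma scalar_dvd_matrix:
  fixes L :: "int^'d::finite^'d"
  assumes "\<And>k. e dvd u $ k"
  shows "e dvd (L *v u) $ k"
  using assms by (simp add: matrix_vector_mult_def dvd_sum)

lemma matrix_scalar_commute: "(L :: int^'n::finite^'m::finite) *v (e *s u) = e *s (L *v u)"
  by (simp add: matrix_vector_mult_def vec_eq_iff sum_distrib_left algebra_simps)

text \<open>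
  By the pigeonhole principle the kernels of $L^m$ modulo $e \le N$ are constant once $m$ reaches the
  number $N^d$ of residue vectors.
\<close>

lemma kernels_stabilise:
  fixes L :: "int^'d::finite^'d"
  obtains c where "\<And>e v m k. 1 \<le> e \<Longrightarrow> e \<le> int N \<Longrightarrow> (\<And>k. e dvd (mat_pow L m *v v) $ k) \<Longrightarrow>
    e dvd (mat_pow L c *v v) $ k"
proof (rule that)
  \<comment> \<open>Residues are bounded by \<open>N\<close> rather than by \<open>e\<close>, so
    that the resulting exponent is the same for all moduli.\<close>
  define R where "R = {u :: int^'d. \<forall>i. u $ i \<in> {0..<int N}}"
  have R: "finite R" unfolding R_def by (rule finite_vec_coordinates) simp
  fix e :: int and v m k
  assume e: "1 \<le> e" "e \<le> int N" and m: "\<And>k. e dvd (mat_pow L m *v v) $ k"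
  define res where "res i = (\<chi> k. (mat_pow L i *v v) $ k mod e)" for i
  have res_eq: "res i = res j \<longleftrightarrow> (\<forall>k. e dvd (mat_pow L i *v v - mat_pow L j *v v) $ k)" for i j
    by (simp add: res_def vec_eq_iff mod_eq_dvd_iff)
  have step: "res (t + i) = res (t + j)" if "res i = res j" for i j t
  proof -
    have "mat_pow L (t + i) *v v - mat_pow L (t + j) *v v
      = mat_pow L t *v (mat_pow L i *v v - mat_pow L j *v v)"
      by (simp add: mat_pow_add_vec matrix_vector_mult_diff_distrib)
    then show ?thesis
      using that unfolding res_eq by (simp add: scalar_dvd_matrix)
  qed
  have zero: "e dvd (mat_pow L (t + i) *v v) $ k" if "\<And>k. e dvd (mat_pow L i *v v) $ k" for i t k
    using that by (simp add: mat_pow_add_vec scalar_dvd_matrix)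
  have "res ` {..card R} \<subseteq> R"
  proof (clarsimp simp: res_def R_def e)
    fix i k
    have "(mat_pow L i *v v) $ k mod e < e"
      using e by (intro pos_mod_bound) auto
    from order_less_le_trans[OF this e(2)]
    show "0 \<le> (mat_pow L i *v v) $ k mod e \<and> (mat_pow L i *v v) $ k mod e < int N"
      using e by simp
  qed
  then have "card (res ` {..card R}) < card {..card R}"
    using card_mono[OF R] by (simp add: le_imp_less_Suc)
  then obtain i' j' where ij': "i' \<le> card R" "j' \<le> card R" "i' \<noteq> j'" "res i' = res j'"
    using pigeonhole by (metis atMost_iff inj_onI)
  define i where "i = min i' j'"
  define p where "p = max i' j' - i"
  have ip: "i \<le> card R" "p > 0" "res (i + p) = res i"
    using ij' by (auto simp: i_def p_def min_def max_def)
  have "res (i + t * p) = res i" for t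
  proof (induction t)
    case (Suc t)
    have "res (t * p + (i + p)) = res (t * p + i)" by (rule step[OF ip(3)])
    with Suc show ?case by (simp add: algebra_simps)
  qed simp
  \<comment> \<open>The index i + m p is at least m, where the residue vanishes; periodicity carries
    this back to i, which is at most \<open>card R\<close>.\<close>
  then have "res (i + m * p) = res i" .
  moreover have "m \<le> i + m * p" using ip(2) by (simp add: trans_le_add2)
  then have "e dvd (mat_pow L (i + m * p) *v v) $ k" for k
    using zero[OF m, of "i + m * p - m"] by simp
  ultimately have "e dvd (mat_pow L i *v v) $ k" for k
    by (metis (no_types, lifting) dvd_eq_mod_eq_0 res_def vec_lambda_beta)
  then show "e dvd (mat_pow L (card R) *v v) $ k"
    using zero[of i "card R - i"] ip(1) by simp
qed


section \<open>Recognizability of factors\<close>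

text \<open>The window is fixed here because later bounds must not depend on the level:
  \<open>stable_D\<close> transports it unchanged from the letters of \<open>Z n x\<close> to those
  of \<open>x\<close>.\<close>

locale css_factor = primitive_css A L F \<zeta>
  for A :: "'a set" and L :: "int^'d::finite^'d" and F :: "(int^'d) set"
    and \<zeta> :: "'a \<Rightarrow> int^'d \<Rightarrow> 'a" +
  fixes B :: "'b set" and Y :: "(int^'d \<Rightarrow> 'b) set" and \<tau> :: "(int^'d \<Rightarrow> 'a) \<Rightarrow> int^'d \<Rightarrow> 'b"
    and D :: "(int^'d) set"
  assumes \<tau>: "factor_map A X B Y \<tau>"
    and aperiodic_Y: "aperiodic Y"
    and finite_D: "finite D" and zero_in_D: "0 \<in> D"
    and stable_D: "\<And>n f f' f'' d. f \<in> Fn n \<Longrightarrow> f' \<in> Fn n \<Longrightarrow> f'' \<in> Fn n \<Longrightarrow> d \<in> D \<Longrightarrow>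
      \<exists>e\<in>D. \<exists>g\<in>Fn n. f + f' - f'' + d = Lp n *v e + g"
    and window_D: "\<And>x x'. x \<in> X \<Longrightarrow> x' \<in> X \<Longrightarrow> (\<And>d. d \<in> D \<Longrightarrow> x d = x' d) \<Longrightarrow> \<tau> x 0 = \<tau> x' 0"
begin

abbreviation "T n x \<equiv> \<tau> (Z n x)"

lemma \<tau>_shift: "x \<in> X \<Longrightarrow> \<tau> (shift n x) = shift n (\<tau> x)"
  using \<tau> by (simp add: factor_map_def)

lemma \<tau>_image: "\<tau> ` X = Y"
  using \<tau> by (simp add: factor_map_def)

lemma \<tau>_at: "x \<in> X \<Longrightarrow> \<tau> x k = \<tau> (shift k x) 0"
  by (subst \<tau>_shift) (simp_all add: shift_def)

lemma shift_T: "x \<in> X \<Longrightarrow> shift (Lp n *v k) (T n x) = T n (shift k x)"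
  by (simp add: \<tau>_shift[symmetric] Z_X shift_Z)

text \<open>Locality with the same window at every level: the window around a point of a supertile
  only meets supertiles whose offset is in \<open>D\<close>.\<close>

lemma T_cong:
  assumes x: "x \<in> X" "x' \<in> X" and eq: "\<And>d. d \<in> D \<Longrightarrow> x (j + d) = x' (j' + d)" and g: "g \<in> Fn n"
  shows "T n x (Lp n *v j + g) = T n x' (Lp n *v j' + g)"
proof -
  have "shift (Lp n *v j + g) (Z n x) d = shift (Lp n *v j' + g) (Z n x') d" if d: "d \<in> D" for d
  proof -
    obtain e h where eh: "e \<in> D" "h \<in> Fn n" "g + d = Lp n *v e + h"
      using stable_D[of g n 0 0 d] g d by auto
    have "Lp n *v i + (g + d) = Lp n *v (i + e) + h" for i
      using eh by (simp add: matrix_vector_right_distrib add.assoc)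
    then show ?thesis
      using Z_cong[of h n x "j + e" x' "j' + e"] eh(2) eq[OF eh(1)] by (simp only: shift_def add.assoc)
  qed
  then have "\<tau> (shift (Lp n *v j + g) (Z n x)) 0 = \<tau> (shift (Lp n *v j' + g) (Z n x')) 0"
    using x by (intro window_D X_shift Z_X) auto
  then show ?thesis
    using x \<tau>_at[of "Z n x" "Lp n *v j + g"] \<tau>_at[of "Z n x'" "Lp n *v j' + g"]
    by (simp add: Z_X)
qed

lemma ptlim_\<tau>:
  assumes x: "\<And>i. x i \<in> X" "l \<in> X" "ptlim x l"
  shows "ptlim (\<lambda>i. \<tau> (x i)) (\<tau> l)"
  unfolding ptlim_def
proof
  fix k
  have "\<forall>\<^sub>F i in sequentially. \<forall>d\<in>D. shift k (x i) d = shift k l d"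
    using x finite_D by (intro ptlim_finite ptlim_shift)
  then show "\<forall>\<^sub>F i in sequentially. \<tau> (x i) k = \<tau> l k"
  proof eventually_elim
    case (elim i)
    then show ?case
      using x window_D[of "shift k (x i)" "shift k l"] by (simp add: X_shift \<tau>_at[of "x i" k] \<tau>_at[of l k])
  qed
qed

lemma ptlim_T:
  assumes x: "\<And>i. x i \<in> X" "l \<in> X" "ptlim x l"
  shows "ptlim (\<lambda>i. T n (x i)) (T n l)"
  using x by (intro ptlim_\<tau> ptlim_Z Z_X)

text \<open>
  If too many phases $p$ admit a desubstitution of $y$, then two of the desubstituted points agree
  on a window that contains all small patterns. Hence the difference of their phases is a period
  of all patterns $T^n$ of small patterns, and thus of a whole point.
\<close>

lemma bounded_phases:
  obtains N where "\<And>n y P. P \<subseteq> Fn n \<Longrightarrow> (\<And>p. p \<in> P \<Longrightarrow> \<exists>x\<in>X. shift p y = T n x) \<Longrightarrow> card P \<le> N"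
proof -
  \<comment> \<open>The sum D + D is needed because moving by a difference of phases changes the
    supertile by an element of \<open>D\<close>, and \<open>T_cong\<close> looks a further
    \<open>D\<close> around it.\<close>
  define D' where "D' = (\<lambda>(d, d'). d + d') ` (D \<times> D)"
  have D': "d + d' \<in> D'" if "d \<in> D" "d' \<in> D" for d d'
    using that by (auto simp: D'_def)
  have D'0: "d \<in> D'" if "d \<in> D" for d
    using D'[OF zero_in_D that] by simp
  have "finite D'" using finite_D by (simp add: D'_def)
  then obtain V where V: "finite V" "\<And>x x'. x \<in> X \<Longrightarrow> x' \<in> X \<Longrightarrow> \<exists>v\<in>V. \<forall>d\<in>D'. x (v + d) = x' d"
    using uniformly_recurrent by blast
  define W where "W = (\<lambda>(v, d). v + d) ` (V \<times> D')"
  have W: "v + d \<in> W" if "v \<in> V" "d \<in> D'" for v d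
    using that by (auto simp: W_def)
  have "finite W" using V \<open>finite D'\<close> by (simp add: W_def)
  then have fin: "finite (PiE W (\<lambda>_. A))" using finite_A by (rule finite_PiE)
  show ?thesis
  proof (rule that, rule ccontr)
    fix n y P
    assume P: "P \<subseteq> Fn n" "\<And>p. p \<in> P \<Longrightarrow> \<exists>x\<in>X. shift p y = T n x"
      and card: "\<not> card P \<le> card (PiE W (\<lambda>_. A))"
    from P(2) obtain \<xi> where \<xi>: "\<And>p. p \<in> P \<Longrightarrow> \<xi> p \<in> X" "\<And>p. p \<in> P \<Longrightarrow> shift p y = T n (\<xi> p)"
      by metis
    have "(\<lambda>p. restrict (\<xi> p) W) ` P \<subseteq> PiE W (\<lambda>_. A)"
      using \<xi>(1) by (auto simp: X_in)
    with card have "\<not> inj_on (\<lambda>p. restrict (\<xi> p) W) P"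
      using card_inj_on_le[OF _ _ fin] by blast
    then obtain p p' where p: "p \<in> P" "p' \<in> P" "p \<noteq> p'" "restrict (\<xi> p) W = restrict (\<xi> p') W"
      by (auto simp: inj_on_def)
    then have agree: "\<xi> p w = \<xi> p' w" if "w \<in> W" for w
      using that by (metis restrict_apply')
    define z where "z = T n (\<xi> p)"
    define q where "q = p' - p"
    have x: "\<xi> p \<in> X" "\<xi> p' \<in> X" using \<xi>(1) p by auto
    have shifted: "T n (\<xi> p') t = z (t + q)" for t
    proof -
      have "T n (\<xi> p') t = y (p' + t)"
        by (simp add: \<xi>(2)[OF p(2), symmetric] shift_def)
      moreover have "z (t + q) = y (p + (t + q))"
        by (simp add: z_def \<xi>(2)[OF p(1), symmetric] shift_def)
      ultimately show ?thesis by (simp add: q_def algebra_simps)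
    qed
    \<comment> \<open>Both desubstituted points agree around every element of \<open>V\<close>, and
      \<open>T n (\<xi> p')\<close> is \<open>z\<close> moved by \<open>q\<close>.\<close>
    have local: "z (Lp n *v v + g + q) = z (Lp n *v v + g)" if "v \<in> V" "g \<in> Fn n" for v g
    proof -
      have "T n (\<xi> p') (Lp n *v v + g) = T n (\<xi> p) (Lp n *v v + g)"
        using that x by (intro T_cong) (auto simp: agree W D'0)
      then show ?thesis by (simp add: shifted z_def)
    qed
    have "z (t + q) = z t" for t
    proof -
      obtain j g where g: "g \<in> Fn n" "t = Lp n *v j + g" by (rule Fn_decomp)
      \<comment> \<open>The surroundings of \<open>j\<close> reappear at some \<open>v\<close> in
        \<open>V\<close>. The value at t + q is carried there, \<open>q\<close> is removed by the
        local period, and the value is carried back.\<close>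
      obtain v where v: "v \<in> V" "\<forall>d\<in>D'. \<xi> p (v + d) = shift j (\<xi> p) d"
        using V(2)[OF x(1) X_shift[OF x(1)]] by blast
      obtain e h where eh: "e \<in> D" "h \<in> Fn n" "g + p' - p + 0 = Lp n *v e + h"
        using stable_D[of g n p' p 0] g p P(1) zero_in_D by blast
      have move: "Lp n *v i + g + q = Lp n *v (i + e) + h" for i
        using eh by (simp add: q_def matrix_vector_right_distrib algebra_simps)
      have "z (t + q) = z (Lp n *v (j + e) + h)"
        by (simp only: g move)
      also have "\<dots> = z (Lp n *v (v + e) + h)"
        unfolding z_def using x eh v by (intro T_cong) (auto simp: shift_def add.assoc D')
      also have "\<dots> = z (Lp n *v v + g + q)"
        by (simp only: move)
      also have "\<dots> = z (Lp n *v v + g)"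
        using v g by (intro local)
      also have "\<dots> = z t"
        unfolding z_def g(2) using x g v by (intro T_cong) (auto simp: shift_def D'0)
      finally show ?thesis .
    qed
    moreover have "z \<in> Y"
      using x \<tau>_image by (auto simp: z_def Z_X)
    ultimately show False
      using aperiodic_Y p(3) unfolding aperiodic_def by (metis eq_iff_diff_eq_0 q_def)
  qed
qed

text \<open>\<open>p\<close> is any integer vector and not a residue in F_n, so multiples of it can
  be formed without reduction.\<close>

definition same_phase :: "nat \<Rightarrow> int^'d \<Rightarrow> bool" where
  "same_phase n p \<longleftrightarrow> (\<exists>x\<in>X. \<exists>x'\<in>X. shift p (T n x) = T n x')"

text \<open>By minimality it does not matter at which point two phases are the same.\<close>

lemma same_phase_all:
  assumes "same_phase n p" and x': "x' \<in> X"
  shows "\<exists>x\<in>X. shift p (T n x') = T n x"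
proof -
  obtain u u' where u: "u \<in> X" "u' \<in> X" "shift p (T n u) = T n u'"
    using assms(1) by (auto simp: same_phase_def)
  have "\<exists>k. \<forall>d\<in>initial i. u (k + d) = x' d" for i
    using uniformly_recurrent[OF finite_initial[of i]] u(1) x' by metis
  then obtain k where k: "\<And>i d. d \<in> initial i \<Longrightarrow> u (k i + d) = x' d"
    by metis
  obtain r l where r: "strict_mono r" "ptlim (\<lambda>i. shift (k (r i)) u') l"
    using ptlim_compact[OF finite_A, of "\<lambda>i. shift (k i) u'"] X_in[OF X_shift[OF u(2)]] by blast
  have l: "l \<in> X"
    using X_ptlim[OF _ r(2)] u X_shift by blast
  have "ptlim (\<lambda>i. shift (k i) u) x'"
    by (rule ptlim_initial) (simp add: shift_def k)
  then have "ptlim (\<lambda>i. shift (k (r i)) u) x'"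
    using r(1) by (rule ptlim_subseq)
  then have "ptlim (\<lambda>i. shift p (T n (shift (k (r i)) u))) (shift p (T n x'))"
    using u x' by (intro ptlim_shift ptlim_T X_shift)
  \<comment> \<open>Shifts by L^n j commute with the shift by p, so one coincidence holds along the
    whole orbit and passes to its limits.\<close>
  moreover have "shift p (T n (shift j u)) = T n (shift j u')" for j
    using u by (simp add: shift_T[symmetric] add.commute flip: u(3))
  ultimately have "ptlim (\<lambda>i. T n (shift (k (r i)) u')) (shift p (T n x'))"
    by simp
  moreover have "ptlim (\<lambda>i. T n (shift (k (r i)) u')) (T n l)"
    using r l u by (intro ptlim_T X_shift)
  ultimately have "shift p (T n x') = T n l"
    by (rule ptlim_unique)
  with l show ?thesis by blast
qed

text \<open>Each further shift by \<open>p\<close> starts at the point supplied by the previous one;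
  hence the need for a coincidence at every point.\<close>

lemma same_phase_multiple:
  assumes "same_phase n p" and "x' \<in> X"
  shows "\<exists>x\<in>X. shift (int e *s p) (T n x') = T n x"
proof (induction e)
  case 0
  then show ?case using assms(2) by (intro bexI[of _ x']) auto
next
  case (Suc e)
  then obtain x where x: "x \<in> X" "shift (int e *s p) (T n x') = T n x" by blast
  have "int (Suc e) *s p = p + int e *s p"
    by (simp add: vec_eq_iff algebra_simps)
  then have "shift (int (Suc e) *s p) (T n x') = shift p (T n x)"
    by (simp add: x(2)[symmetric])
  then show ?case using same_phase_all[OF assms(1) x(1)] by metis
qed

text \<open>The multiples 0, ..., N of \<open>p\<close> reduce to phases of a single image, of which
  at most N are distinct. Two multiples with the same phase differ by a vector of L^n Z^d.\<close>

lemma same_phase_torsion: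
  obtains N where "\<And>n p. same_phase n p \<Longrightarrow> \<exists>e v. 1 \<le> e \<and> e \<le> int N \<and> e *s p = Lp n *v v"
proof -
  obtain N where N: "\<And>n y P. P \<subseteq> Fn n \<Longrightarrow> (\<And>p. p \<in> P \<Longrightarrow> \<exists>x\<in>X. shift p y = T n x) \<Longrightarrow> card P \<le> N"
    using bounded_phases by blast
  show ?thesis
  proof (rule that)
    fix n p assume p: "same_phase n p"
    obtain x\<^sub>0 where x0: "x\<^sub>0 \<in> X" using X_nonempty by blast
    have "\<exists>j f. f \<in> Fn n \<and> int e *s p = Lp n *v j + f" for e
      by (meson Fn_decomp)
    then obtain j f where f: "\<And>e. f e \<in> Fn n" "\<And>e. int e *s p = Lp n *v j e + f e"
      by metis
    have "\<exists>x\<in>X. shift q (T n x\<^sub>0) = T n x" if q: "q \<in> f ` {..N}" for q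
    proof -
      obtain e where e: "q = f e" using q by blast
      obtain x where x: "x \<in> X" "shift (int e *s p) (T n x\<^sub>0) = T n x"
        using same_phase_multiple[OF p x0] by blast
      have "q = Lp n *v (- j e) + int e *s p"
        using matrix_vector_mult_diff_distrib[of "Lp n" 0 "j e"] by (simp add: e f(2))
      then have "shift q (T n x\<^sub>0) = shift (Lp n *v (- j e)) (T n x)"
        by (simp add: x(2)[symmetric])
      also have "\<dots> = T n (shift (- j e) x)"
        by (rule shift_T[OF x(1)])
      finally show ?thesis using x(1) X_shift by blast
    qed
    then have "card (f ` {..N}) \<le> N"
      using f(1) by (intro N) auto
    then have "\<not> inj_on f {..N}"
      using card_image[of f "{..N}"] by auto
    then obtain a b where ab: "a \<le> N" "b \<le> N" "a < b" "f a = f b"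
      by (auto simp: inj_on_def) (metis linorder_neqE_nat)
    have "int (b - a) *s p = int b *s p - int a *s p"
      using ab(3) by (simp add: vec_eq_iff algebra_simps of_nat_diff)
    also have "\<dots> = Lp n *v (j b - j a)"
      by (simp add: f(2) ab(4) matrix_vector_mult_diff_distrib)
    finally show "\<exists>e v. 1 \<le> e \<and> e \<le> int N \<and> e *s p = Lp n *v v"
      using ab by (intro exI[of _ "int (b - a)"] exI[of _ "j b - j a"]) auto
  qed
qed

text \<open>Desubstituting both points m more times costs only two phases in F_m, which are seen at
  level n as a vector of L^n Z^d.\<close>

lemma same_phase_lift:
  assumes "same_phase n p"
  obtains k where "same_phase (n + m) (p + Lp n *v k)"
proof -
  obtain x x' where x: "x \<in> X" "x' \<in> X" "shift p (T n x) = T n x'"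
    using assms by (auto simp: same_phase_def)
  obtain f u where u: "u \<in> X" "x = shift f (Z m u)" using desubstitute[OF x(1), of m] by blast
  obtain f' u' where u': "u' \<in> X" "x' = shift f' (Z m u')" using desubstitute[OF x(2), of m] by blast
  have "T n x = shift (Lp n *v f) (T (n + m) u)" "T n x' = shift (Lp n *v f') (T (n + m) u')"
    using u u' by (simp_all add: Z_add shift_T Z_X)
  then have "shift (- (Lp n *v f')) (shift (p + Lp n *v f) (T (n + m) u)) = T (n + m) u'"
    using x(3) by simp
  moreover have "- (Lp n *v f') + (p + Lp n *v f) = p + Lp n *v (f - f')"
    by (simp add: matrix_vector_mult_diff_distrib)
  ultimately have "shift (p + Lp n *v (f - f')) (T (n + m) u) = T (n + m) u'"
    by (metis shift_shift)
  then show ?thesis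
    using that u u' unfolding same_phase_def by blast
qed

text \<open>
  A coincidence of phases at level $n$ lifts to all higher levels $m$, where its order modulo
  $L^m$ is bounded. Since the kernels of the powers of $L$ stabilise, it is trivial at level $n$.
\<close>

theorem recognizable:
  assumes "same_phase n p"
  obtains v where "p = Lp n *v v"
proof -
  obtain N where N: "\<And>n p. same_phase n p \<Longrightarrow> \<exists>e v. 1 \<le> e \<and> e \<le> int N \<and> e *s p = Lp n *v v"
    using same_phase_torsion by blast
  obtain c where c: "\<And>e v m k. 1 \<le> e \<Longrightarrow> e \<le> int N \<Longrightarrow> (\<And>k. e dvd (Lp m *v v) $ k) \<Longrightarrow>
    e dvd (Lp c *v v) $ k"
    using kernels_stabilise by blast
  obtain k where k: "same_phase (n + c) (p + Lp n *v k)"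
    using same_phase_lift[OF assms] .
  obtain e v where e: "1 \<le> e" "e \<le> int N" "e *s (p + Lp n *v k) = Lp (n + c) *v v"
    using N[OF k] by blast
  have "e dvd (Lp (n + c) *v v) $ i" for i
    by (simp add: e(3)[symmetric])
  \<comment> \<open>The choice of \<open>c\<close> lowers the exponent from n + c to c, so L^n can
    be kept outside when L^c v is divided by e.\<close>
  then have *: "e dvd (Lp c *v v) $ i" for i
    using c[OF e(1,2)] by blast
  define w where "w = (\<chi> i. (Lp c *v v) $ i div e)"
  have "Lp c *v v = e *s w"
    using * by (simp add: w_def vec_eq_iff)
  then have "e *s (p + Lp n *v k) = e *s (Lp n *v w)"
    by (simp only: e(3) mat_pow_add_vec matrix_scalar_commute)
  then have "e * (p + Lp n *v k) $ i = e * (Lp n *v w) $ i" for i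
    by (metis vector_smult_component)
  then have "p + Lp n *v k = Lp n *v w"
    using e(1) by (metis mult_cancel_left not_one_le_zero vec_eq_iff)
  then have "p = Lp n *v (w - k)"
    by (simp add: matrix_vector_mult_diff_distrib algebra_simps)
  then show ?thesis using that by blast
qed

end

section \<open>Letters as pairs of a class and a position\<close>

lemma (in css) continuous_window:
  assumes "continuous_map (subtopology (config_topology A) X) (subtopology (config_topology B) Y) \<tau>"
  obtains D where "finite D" "\<forall>x\<in>X. \<forall>x'\<in>X. (\<forall>k\<in>D. x k = x' k) \<longrightarrow> \<tau> x m = \<tau> x' m"
proof (rule finite_window[of A X "\<lambda>x. \<tau> x m"])
  show "finite A" by (rule finite_A)
  show "x k \<in> A" if "x \<in> X" for x k using that by (rule X_in)
  show "l \<in> X" if "\<And>i. x i \<in> X" "ptlim x l" for x l using that by (rule X_ptlim)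
  show "\<forall>\<^sub>F i in sequentially. \<tau> (x i) m = \<tau> l m" if "\<And>i. x i \<in> X" "l \<in> X" "ptlim x l" for x l
    using assms X_in that by (rule continuous_map_config_ptlim)
  fix D :: "(int^'d) set"
  assume "finite D" "\<And>x x'. x \<in> X \<Longrightarrow> x' \<in> X \<Longrightarrow> (\<And>k. k \<in> D \<Longrightarrow> x k = x' k) \<Longrightarrow> \<tau> x m = \<tau> x' m"
  then show thesis using that by blast
qed

section \<open>Stabilisation of the level equivalences\<close>

context css_factor
begin

definition level_eq :: "nat \<Rightarrow> ((int^'d \<Rightarrow> 'a) \<times> (int^'d \<Rightarrow> 'a)) set" where
  "level_eq n = {(x, x'). x \<in> X \<and> x' \<in> X \<and> (\<forall>f\<in>Fn n. T n x f = T n x' f)}"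

lemma T_add:
  assumes "x \<in> X"
  shows "T (n + m) x (h + Lp n *v g) = T n (shift g (Z m x)) h"
proof -
  have "T n (shift g (Z m x)) h = shift (Lp n *v g) (T n (Z m x)) h"
    using assms by (simp add: shift_T Z_X)
  then show ?thesis by (simp only: Z_add shift_def add.commute[of h])
qed

text \<open>For fixed \<open>m\<close> the right side depends on \<open>n\<close> only through
  \<open>level_eq n\<close>; therefore equality of two levels persists when \<open>m\<close> is
  added to both.\<close>

lemma level_eq_add:
  "(x, x') \<in> level_eq (n + m) \<longleftrightarrow>
    x \<in> X \<and> x' \<in> X \<and> (\<forall>g\<in>Fn m. (shift g (Z m x), shift g (Z m x')) \<in> level_eq n)"
proof -
  have "(\<forall>f\<in>Fn (n + m). T (n + m) x f = T (n + m) x' f) \<longleftrightarrow>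
      (\<forall>g\<in>Fn m. \<forall>h\<in>Fn n. T n (shift g (Z m x)) h = T n (shift g (Z m x')) h)"
    if x: "x \<in> X" "x' \<in> X"
  proof -
    have "(\<forall>f\<in>Fn (n + m). T (n + m) x f = T (n + m) x' f) \<longleftrightarrow>
        (\<forall>g\<in>Fn m. \<forall>h\<in>Fn n. T (n + m) x (h + Lp n *v g) = T (n + m) x' (h + Lp n *v g))"
      unfolding iter_support_add by blast
    then show ?thesis
      by (simp only: T_add[OF x(1)] T_add[OF x(2)])
  qed
  then show ?thesis
    by (auto simp: level_eq_def X_shift Z_X)
qed

lemma level_eq_window:
  assumes "x \<in> X" "x' \<in> X" "\<And>d. d \<in> D \<Longrightarrow> x d = x' d"
  shows "(x, x') \<in> level_eq n"
  using assms T_cong[of x x' 0 0 _ n] by (simp add: level_eq_def)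

lemma level_eq_equiv:
  "x \<in> X \<Longrightarrow> (x, x) \<in> level_eq n"
  "(x, x') \<in> level_eq n \<Longrightarrow> (x', x) \<in> level_eq n"
  "(x, x') \<in> level_eq n \<Longrightarrow> (x', x'') \<in> level_eq n \<Longrightarrow> (x, x'') \<in> level_eq n"
  by (auto simp: level_eq_def)

lemma finite_windows: "finite ((\<lambda>x. restrict x D) ` X)"
proof (rule finite_subset)
  show "(\<lambda>x. restrict x D) ` X \<subseteq> PiE D (\<lambda>_. A)" by (auto simp: X_in)
  show "finite (PiE D (\<lambda>_. A))" using finite_D finite_A by (rule finite_PiE)
qed

text \<open>By \<open>level_eq_window\<close> each relation is determined by the set of pairs of
  patterns on \<open>D\<close> that it relates, and there are finitely many such sets.\<close>

lemma finite_level_eqs: "finite (range level_eq)"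
proof -
  let ?W = "(\<lambda>x. restrict x D) ` X"
  let ?r = "\<lambda>(x, x'). (restrict x D, restrict x' D)"
  let ?R = "\<lambda>e. {(x, x'). x \<in> X \<and> x' \<in> X \<and> (restrict x D, restrict x' D) \<in> e}"
  have restrictD: "u d = x d" if "restrict u D = restrict x D" "d \<in> D" for u x :: "int^'d \<Rightarrow> 'a" and d
    using that by (metis restrict_apply')
  have rec: "level_eq n = ?R (?r ` level_eq n)" for n
  proof (intro set_eqI iffI)
    fix p assume "p \<in> level_eq n"
    then show "p \<in> ?R (?r ` level_eq n)" by (force simp: level_eq_def)
  next
    fix p assume "p \<in> ?R (?r ` level_eq n)"
    then obtain x x' u u' where p: "p = (x, x')" "x \<in> X" "x' \<in> X" "(u, u') \<in> level_eq n"
      "restrict u D = restrict x D" "restrict u' D = restrict x' D" by auto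
    then have "u \<in> X" "u' \<in> X" by (auto simp: level_eq_def)
    then have "(x, u) \<in> level_eq n" "(u', x') \<in> level_eq n"
      using p(2,3) restrictD[OF p(5)] restrictD[OF p(6)] by (auto intro!: level_eq_window)
    with p(1,4) show "p \<in> level_eq n" using level_eq_equiv(3) by metis
  qed
  have mem: "?r ` level_eq n \<in> Pow (?W \<times> ?W)" for n
    by (auto simp: level_eq_def)
  have "level_eq n \<in> ?R ` Pow (?W \<times> ?W)" for n
    by (intro image_eqI[where x = "?r ` level_eq n"] rec mem)
  then have "range level_eq \<subseteq> ?R ` Pow (?W \<times> ?W)"
    by (rule image_subsetI)
  then show ?thesis
    by (rule finite_subset) (intro finite_imageI finite_Pow_iff[THEN iffD2] finite_SigmaI finite_windows)
qed

lemma stable_level: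
  obtains n where "n \<ge> 1" "level_eq (n + n) = level_eq n"
proof -
  have "\<not> inj level_eq"
    using finite_level_eqs finite_imageD by blast
  then obtain a b where "a \<noteq> b" "level_eq a = level_eq b"
    by (auto simp: inj_def)
  then obtain i j where ij: "i < j" "level_eq i = level_eq j"
    by (metis linorder_neqE_nat)
  define p where "p = j - i"
  have p: "p > 0" "level_eq (i + p) = level_eq i"
    using ij by (simp_all add: p_def)
  have shift: "level_eq (i + p + t) = level_eq (i + t)" for t
    by (simp only: set_eq_iff split_paired_All level_eq_add[of _ _ "i + p" t] level_eq_add[of _ _ i t] p(2) simp_thms)
  have period: "level_eq (i + t + s * p) = level_eq (i + t)" for s t
  proof (induction s)
    case (Suc s)
    then show ?case using shift[of "t + s * p"] by (simp add: algebra_simps)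
  qed simp
  \<comment> \<open>A multiple of the period beyond the preperiod, so adding n is adding i + 1
    periods; the factor i + 1 also gives n \<ge> 1.\<close>
  define n where "n = (i + 1) * p"
  have "(i + 1) * 1 \<le> n" unfolding n_def using p(1) by (intro mult_le_mono2) simp
  then have "i + 1 \<le> n" by simp
  then have "level_eq (n + n) = level_eq n"
    using period[of "n - i" "i + 1"] by (simp add: n_def)
  with \<open>i + 1 \<le> n\<close> show ?thesis using that[of n] by simp
qed

text \<open>Numbering the pairs of a class and a position gives an alphabet of natural numbers;
  afterwards only equality of codes matters.\<close>

lemma finite_coding:
  obtains code :: "(int^'d \<Rightarrow> 'a) \<Rightarrow> int^'d \<Rightarrow> nat"
  where "\<And>x x' g g'. x \<in> X \<Longrightarrow> x' \<in> X \<Longrightarrow> g \<in> Fn n \<Longrightarrow> g' \<in> Fn n \<Longrightarrow>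
      code x g = code x' g' \<longleftrightarrow> g = g' \<and> (x, x') \<in> level_eq n"
    and "finite {code x g | x g. x \<in> X \<and> g \<in> Fn n}"
proof -
  let ?w = "\<lambda>x. restrict (T n x) (Fn n)"
  have w: "?w x = ?w x' \<longleftrightarrow> (x, x') \<in> level_eq n" if "x \<in> X" "x' \<in> X" for x x'
    using that by (auto simp: level_eq_def restrict_def fun_eq_iff)
  have "\<exists>u\<in>X. restrict u D = restrict x D" if "x \<in> X" for x
    using that by blast
  then obtain u where u: "\<And>x. x \<in> X \<Longrightarrow> u (restrict x D) \<in> X"
    "\<And>x. x \<in> X \<Longrightarrow> restrict (u (restrict x D)) D = restrict x D"
    using bchoice[of "(\<lambda>x. restrict x D) ` X" "\<lambda>v u. u \<in> X \<and> restrict u D = v"] by auto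
  have "?w ` X \<subseteq> ?w ` u ` (\<lambda>x. restrict x D) ` X"
  proof clarify
    fix x assume x: "x \<in> X"
    have "(x, u (restrict x D)) \<in> level_eq n"
      using u[OF x] x by (intro level_eq_window) (metis restrict_apply')+
    then have "?w x = ?w (u (restrict x D))" using w x u by blast
    then show "?w x \<in> ?w ` u ` (\<lambda>x. restrict x D) ` X" using x by blast
  qed
  then have fin: "finite (?w ` X \<times> Fn n)"
    using finite_subset[OF _ finite_imageI[OF finite_imageI[OF finite_windows]]]
    by (intro finite_SigmaI finite_Fn)
  then obtain enc :: "(int^'d \<Rightarrow> 'b) \<times> (int^'d) \<Rightarrow> nat" where enc: "inj_on enc (?w ` X \<times> Fn n)"
    using finite_imp_inj_to_nat_seg by metis
  show ?thesis
  proof (rule that[of "\<lambda>x g. enc (?w x, g)"])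
    show "enc (?w x, g) = enc (?w x', g') \<longleftrightarrow> g = g' \<and> (x, x') \<in> level_eq n"
      if "x \<in> X" "x' \<in> X" "g \<in> Fn n" "g' \<in> Fn n" for x x' g g'
      using that inj_on_eq_iff[OF enc, of "(?w x, g)" "(?w x', g')"] w[OF that(1,2)] by auto
    have "{enc (?w x, g) | x g. x \<in> X \<and> g \<in> Fn n} \<subseteq> enc ` (?w ` X \<times> Fn n)" by auto
    then show "finite {enc (?w x, g) | x g. x \<in> X \<and> g \<in> Fn n}"
      using fin by (meson finite_imageI finite_subset)
  qed
qed

end

section \<open>The induced substitution and the coding map\<close>

locale coded_factor = css_factor A L F \<zeta> B Y \<tau> D
  for A :: "'a set" and L :: "int^'d::finite^'d" and F :: "(int^'d) set"
    and \<zeta> :: "'a \<Rightarrow> int^'d \<Rightarrow> 'a" and B :: "'b set" and Y \<tau> D +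
  fixes n :: nat and code :: "(int^'d \<Rightarrow> 'a) \<Rightarrow> int^'d \<Rightarrow> nat"
  assumes n: "n \<ge> 1" and stable: "level_eq (n + n) = level_eq n"
    and code: "\<And>x x' g g'. x \<in> X \<Longrightarrow> x' \<in> X \<Longrightarrow> g \<in> Fn n \<Longrightarrow> g' \<in> Fn n \<Longrightarrow>
      code x g = code x' g' \<longleftrightarrow> g = g' \<and> (x, x') \<in> level_eq n"
    and finite_code: "finite {code x g | x g. x \<in> X \<and> g \<in> Fn n}"
    and Y_in: "\<And>y k. y \<in> Y \<Longrightarrow> y k \<in> B"
begin

definition C :: "nat set" where
  "C = {code x g | x g. x \<in> X \<and> g \<in> Fn n}"

definition rep :: "nat \<Rightarrow> (int^'d \<Rightarrow> 'a) \<times> (int^'d)" where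
  "rep c = (SOME (x, g). x \<in> X \<and> g \<in> Fn n \<and> code x g = c)"

text \<open>The letter of \<open>x\<close> and \<open>g\<close> stands for the point g of the
  supertile of \<open>x\<close> at the origin. One level down this point becomes a supertile itself,
  that of \<open>shift g (Z n x)\<close>.\<close>

definition \<zeta>' :: "nat \<Rightarrow> int^'d \<Rightarrow> nat" where
  "\<zeta>' c h = (case rep c of (x, g) \<Rightarrow> code (shift g (Z n x)) h)"

definition T' :: "nat \<Rightarrow> 'b" where
  "T' c = (case rep c of (x, g) \<Rightarrow> T n x g)"

lemma rep_code:
  assumes "x \<in> X" "g \<in> Fn n"
  obtains x' where "rep (code x g) = (x', g)" "(x', x) \<in> level_eq n"
proof -
  have "case rep (code x g) of (x', g') \<Rightarrow> x' \<in> X \<and> g' \<in> Fn n \<and> code x' g' = code x g"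
    unfolding rep_def by (rule someI[of _ "(x, g)"]) (use assms in simp)
  then show ?thesis
    using code assms that by (cases "rep (code x g)") auto
qed

text \<open>Independence of the representative is where stability enters: level n + n compares the
  points \<open>shift g (Z n x)\<close> at level n, and it coincides with level n.\<close>

lemma \<zeta>'_eq:
  assumes "x \<in> X" "g \<in> Fn n" "h \<in> Fn n"
  shows "\<zeta>' (code x g) h = code (shift g (Z n x)) h"
proof -
  obtain x' where x': "rep (code x g) = (x', g)" "(x', x) \<in> level_eq n"
    using rep_code[OF assms(1,2)] .
  then have "(x', x) \<in> level_eq (n + n)" by (simp add: stable)
  then have "x' \<in> X" "(shift g (Z n x'), shift g (Z n x)) \<in> level_eq n"
    using level_eq_add assms(2) by blast+
  then show ?thesis
    using x' assms by (simp add: \<zeta>'_def code X_shift Z_X)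
qed

lemma T'_eq:
  assumes "x \<in> X" "g \<in> Fn n"
  shows "T' (code x g) = T n x g"
proof -
  obtain x' where "rep (code x g) = (x', g)" "(x', x) \<in> level_eq n"
    using rep_code[OF assms] .
  then show ?thesis using assms(2) by (simp add: T'_def level_eq_def)
qed

lemma \<zeta>'_in: "c \<in> C \<Longrightarrow> h \<in> Fn n \<Longrightarrow> \<zeta>' c h \<in> C"
proof -
  assume "c \<in> C" and h: "h \<in> Fn n"
  then obtain x g where "x \<in> X" "g \<in> Fn n" "c = code x g" by (auto simp: C_def)
  then have "\<zeta>' c h = code (shift g (Z n x)) h" "shift g (Z n x) \<in> X"
    using h by (simp_all add: \<zeta>'_eq X_shift Z_X)
  then show "\<zeta>' c h \<in> C" unfolding C_def using h by blast
qed

lemma css': "constant_shape_substitution C (Lp n) (Fn n) \<zeta>'"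
proof -
  obtain x where "x \<in> X" using X_nonempty by blast
  then have "code x 0 \<in> C" unfolding C_def using zero_in_Fn by blast
  moreover have "foelner (\<lambda>m. Fn (n * m))"
    unfolding foelner_def
  proof
    fix m
    \<comment> \<open>As n \<ge> 1, the new supports form a subsequence of the old Foelner
      sequence.\<close>
    have "strict_mono (\<lambda>m. n * m)" using n by (simp add: strict_mono_def)
    from LIMSEQ_subseq_LIMSEQ[OF foelner[unfolded foelner_def, rule_format, of m] this]
    show "(\<lambda>k. real (card (sym_diff (Fn (n * k)) ((+) m ` Fn (n * k)))) / real (card (Fn (n * k)))) \<longlonglongrightarrow> 0"
      by (simp add: o_def)
  qed
  then have "foelner (iter_support (Lp n) (Fn n))"
    by (simp add: foelner_def iter_support_mult)
  ultimately show ?thesis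
    using finite_code expansion_matrix_pow[OF expansion n] representatives_Fn \<zeta>'_in
    by (auto simp: constant_shape_substitution_def C_def[symmetric])
qed

sublocale c: css C "Lp n" "Fn n" \<zeta>'
  by unfold_locales (rule css')

text \<open>By recognizability, all choices of \<open>u\<close> and \<open>f\<close> yield the same letter.\<close>

definition \<psi> :: "(int^'d \<Rightarrow> 'b) \<Rightarrow> int^'d \<Rightarrow> nat" where
  "\<psi> y k = (SOME c. \<exists>u f j g. u \<in> X \<and> y = shift f (T n u) \<and> g \<in> Fn n \<and>
    k + f = Lp n *v j + g \<and> c = code (shift j u) g)"

lemma \<psi>_eq:
  assumes u: "u \<in> X" and g: "g \<in> Fn n" and k: "k + f = Lp n *v j + g"
  shows "\<psi> (shift f (T n u)) k = code (shift j u) g"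
  unfolding \<psi>_def
proof (rule someI2)
  show "\<exists>u' f' j' g'. u' \<in> X \<and> shift f (T n u) = shift f' (T n u') \<and> g' \<in> Fn n \<and>
    k + f' = Lp n *v j' + g' \<and> code (shift j u) g = code (shift j' u') g'"
    using assms by blast
next
  fix c assume "\<exists>u' f' j' g'. u' \<in> X \<and> shift f (T n u) = shift f' (T n u') \<and> g' \<in> Fn n \<and>
    k + f' = Lp n *v j' + g' \<and> c = code (shift j' u') g'"
  then obtain u' f' j' g' where u': "u' \<in> X" "shift f (T n u) = shift f' (T n u')" "g' \<in> Fn n"
    "k + f' = Lp n *v j' + g'" "c = code (shift j' u') g'" by blast
  have "shift (- f') (shift f (T n u)) = T n u'" by (simp add: u'(2))
  then have eq: "shift (f - f') (T n u) = T n u'" by simp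
  with u u'(1) have "same_phase n (f - f')" unfolding same_phase_def by blast
  then obtain v where v: "f - f' = Lp n *v v" by (rule recognizable)
  \<comment> \<open>Both decompositions put \<open>k\<close> at the same position of its supertile;
    only the index of the supertile moves, by \<open>v\<close>.\<close>
  have "Lp n *v j + g = (k + f') + (f - f')" by (simp add: k[symmetric])
  also have "\<dots> = Lp n *v (j' + v) + g'"
    by (simp add: u'(4) v matrix_vector_right_distrib)
  finally have j: "j = j' + v" "g = g'" using Fn_unique[OF g u'(3)] by blast+
  have "T n (shift j u) h = T n (shift j' u') h" for h
  proof -
    have "T n (shift j' u') h = T n u' (Lp n *v j' + h)"
      by (simp add: shift_T[OF u'(1), symmetric] shift_apply)
    also have "\<dots> = T n u ((f - f') + (Lp n *v j' + h))"
      by (simp add: eq[symmetric] shift_apply)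
    also have "(f - f') + (Lp n *v j' + h) = Lp n *v j + h"
      by (simp add: v j matrix_vector_right_distrib)
    also have "T n u (Lp n *v j + h) = T n (shift j u) h"
      by (simp add: shift_T[OF u, symmetric] shift_apply)
    finally show ?thesis by simp
  qed
  then have "(shift j' u', shift j u) \<in> level_eq n"
    using u u' by (simp add: level_eq_def X_shift)
  then show "c = code (shift j u) g"
    using u' u j g by (simp add: code X_shift)
qed

text \<open>Points of \<open>Y\<close> are handled through preimages in \<open>X\<close>, where the
  old substitution acts.\<close>

abbreviation "\<Phi> x \<equiv> \<psi> (\<tau> x)"

lemma \<Phi>_eq:
  assumes u: "u \<in> X" and g: "g \<in> Fn n" and k: "k + f = Lp n *v j + g"
  shows "\<Phi> (shift f (Z n u)) k = code (shift j u) g"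
  using \<psi>_eq[OF assms] u by (simp add: \<tau>_shift Z_X)

lemma \<Phi>_at:
  assumes "x \<in> X"
  obtains u f j g where "u \<in> X" "x = shift f (Z n u)" "g \<in> Fn n" "k + f = Lp n *v j + g"
    "\<Phi> x k = code (shift j u) g"
proof -
  obtain f u where "u \<in> X" "x = shift f (Z n u)" using desubstitute[OF assms] by blast
  moreover obtain j g where "g \<in> Fn n" "k + f = Lp n *v j + g" by (rule Fn_decomp)
  ultimately show ?thesis using that \<Phi>_eq by blast
qed

lemma \<Phi>_in: "x \<in> X \<Longrightarrow> \<Phi> x k \<in> C"
  by (rule \<Phi>_at[of x k]) (auto simp: C_def intro: X_shift)

lemma \<Phi>_shift:
  assumes "x \<in> X"
  shows "\<Phi> (shift m x) = shift m (\<Phi> x)"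
proof
  fix k
  obtain u f j g where u: "u \<in> X" "x = shift f (Z n u)" "g \<in> Fn n" "(m + k) + f = Lp n *v j + g"
    "\<Phi> x (m + k) = code (shift j u) g" using \<Phi>_at[OF assms, of "m + k"] .
  have "\<Phi> (shift (m + f) (Z n u)) k = code (shift j u) g"
    using u by (intro \<Phi>_eq) (simp_all add: algebra_simps)
  with u show "\<Phi> (shift m x) k = shift m (\<Phi> x) k"
    by (simp add: shift_apply)
qed

lemma T'_\<Phi>:
  assumes "x \<in> X"
  shows "T' (\<Phi> x k) = \<tau> x k"
proof -
  obtain u f j g where u: "u \<in> X" "x = shift f (Z n u)" "g \<in> Fn n" "k + f = Lp n *v j + g"
    "\<Phi> x k = code (shift j u) g" using \<Phi>_at[OF assms] .
  have "T' (\<Phi> x k) = T n (shift j u) g"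
    using u by (simp add: T'_eq X_shift)
  also have "\<dots> = T n u (f + k)"
    using u(1) by (simp only: shift_T[symmetric] shift_apply u(4)[symmetric] add.commute[of f k])
  also have "\<dots> = \<tau> x k"
    using u(1) by (simp add: u(2) \<tau>_shift Z_X shift_apply)
  finally show ?thesis .
qed

text \<open>\<open>x\<close> itself desubstitutes \<open>Z n x\<close> with phase 0, so the letter
  at L^n j + h is that of \<open>shift j x\<close> and \<open>h\<close>, which is what \<zeta>'
  produces from the letter at j.\<close>

lemma \<Phi>_sub:
  assumes "x \<in> X"
  shows "\<Phi> (Z n x) = c.sub (\<Phi> x)"
proof
  fix k
  obtain j h where h: "h \<in> Fn n" "k = Lp n *v j + h" by (rule Fn_decomp)
  obtain u f i g where u: "u \<in> X" "x = shift f (Z n u)" "g \<in> Fn n" "j + f = Lp n *v i + g"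
    "\<Phi> x j = code (shift i u) g" using \<Phi>_at[OF assms] .
  have "shift g (Z n (shift i u)) = shift j x"
    using u by (simp add: shift_Z[symmetric] add.commute flip: u(4))
  then have "c.sub (\<Phi> x) k = code (shift j x) h"
    using u h by (simp add: c.sub_eq \<zeta>'_eq X_shift)
  also have "\<dots> = \<Phi> (Z n x) k"
    using \<Phi>_eq[OF assms h(1), of k 0 j] h(2) by simp
  finally show "\<Phi> (Z n x) k = c.sub (\<Phi> x) k" ..
qed

lemma \<Phi>_Z: "x \<in> X \<Longrightarrow> \<Phi> (Z (n * m) x) = c.Z m (\<Phi> x)"
proof (induction m)
  case (Suc m)
  then show ?case
    using \<Phi>_sub[of "Z (n * m) x"] by (simp add: Z_add Z_X)
qed simp

lemma code_\<Phi>: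
  assumes "x \<in> X" "g \<in> Fn n"
  shows "code x g = \<Phi> (shift g (Z n x)) 0"
  using \<Phi>_eq[of x g 0 g 0] assms by simp

text \<open>Iterates of \<zeta>' on a letter can thus be computed inside coded points, by
  \<open>\<Phi>_Z\<close> and \<open>c.Z_const\<close>.\<close>

lemma C_\<Phi>:
  assumes "c \<in> C"
  obtains x where "x \<in> X" "c = \<Phi> x 0"
proof -
  obtain x g where x: "x \<in> X" "g \<in> Fn n" "c = code x g" using assms by (auto simp: C_def)
  show ?thesis
    by (rule that[of "shift g (Z n x)"]) (use x in \<open>simp_all add: code_\<Phi> X_shift Z_X\<close>)
qed

text \<open>Desubstitutions need not depend continuously on the point, but along a subsequence their
  phases are constant and they converge to a desubstitution of the limit, which computes the same
  letter.\<close>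

lemma \<Phi>_ptlim:
  assumes x: "\<And>i. x i \<in> X" and l: "l \<in> X" "ptlim x l"
  shows "\<forall>\<^sub>F i in sequentially. \<Phi> (x i) k = \<Phi> l k"
proof (rule ccontr)
  assume "\<not> ?thesis"
  then have "infinite {i. \<Phi> (x i) k \<noteq> \<Phi> l k}"
    by (auto simp: infinite_nat_iff_unbounded_le eventually_sequentially)
  from infinite_enumerate[OF this] obtain r :: "nat \<Rightarrow> nat"
    where r: "strict_mono r" "\<And>i. \<Phi> (x (r i)) k \<noteq> \<Phi> l k" by auto
  have "\<exists>f u. f \<in> Fn n \<and> u \<in> X \<and> x (r i) = shift f (Z n u)" for i
    using desubstitute[OF x] by metis
  then obtain f u where fu: "\<And>i. f i \<in> Fn n" "\<And>i. u i \<in> X" "\<And>i. x (r i) = shift (f i) (Z n (u i))"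
    by metis
  obtain h and s :: "nat \<Rightarrow> nat" where s: "strict_mono s" "\<And>i. f (s i) = h"
    using infinitely_often_constant[of "Fn n" f, OF finite_Fn fu(1)] by auto
  obtain t v where t: "strict_mono t" "ptlim (\<lambda>i. u (s (t i))) v"
    using ptlim_compact[OF finite_A, of "\<lambda>i. u (s i)"] X_in[OF fu(2)] by blast
  have v: "v \<in> X" using X_ptlim[OF _ t(2)] fu(2) by blast
  have "strict_mono (\<lambda>i. r (s (t i)))"
    using r(1) s(1) t(1) by (simp add: strict_mono_def)
  then have "ptlim (\<lambda>i. x (r (s (t i)))) l" using l(2) by (rule ptlim_subseq[rotated])
  moreover have "ptlim (\<lambda>i. x (r (s (t i)))) (shift h (Z n v))"
    using ptlim_shift[OF ptlim_Z[OF t(2)], of h n] by (simp add: fu(3) s(2))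
  ultimately have l_eq: "l = shift h (Z n v)" by (rule ptlim_unique)
  obtain j g where g: "g \<in> Fn n" "k + h = Lp n *v j + g" by (rule Fn_decomp)
  have "\<forall>\<^sub>F i in sequentially. \<forall>d\<in>D. shift j (u (s (t i))) d = shift j v d"
    using t(2) finite_D by (intro ptlim_finite ptlim_shift)
  then obtain i where i: "\<forall>d\<in>D. shift j (u (s (t i))) d = shift j v d"
    using eventually_sequentially_ex by blast
  have "(shift j (u (s (t i))), shift j v) \<in> level_eq n"
    using i fu(2) v by (intro level_eq_window X_shift) auto
  then have "code (shift j (u (s (t i)))) g = code (shift j v) g"
    using fu(2) v g by (simp add: code X_shift)
  then have "\<Phi> (x (r (s (t i)))) k = \<Phi> l k"
    using \<Phi>_eq[OF fu(2) g] \<Phi>_eq[OF v g] by (simp add: fu(3) s(2) l_eq)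
  then show False using r(2) by blast
qed

lemma \<Phi>_window:
  obtains E where "finite E" "\<And>x x' k k'. x \<in> X \<Longrightarrow> x' \<in> X \<Longrightarrow>
    (\<And>d. d \<in> E \<Longrightarrow> x (k + d) = x' (k' + d)) \<Longrightarrow> \<Phi> x k = \<Phi> x' k'"
proof (rule finite_window[of A X "\<lambda>x. \<Phi> x 0"])
  show "finite A" by (rule finite_A)
  show "x k \<in> A" if "x \<in> X" for x k using that by (rule X_in)
  show "l \<in> X" if "\<And>i. x i \<in> X" "ptlim x l" for x l using that by (rule X_ptlim)
  show "\<forall>\<^sub>F i in sequentially. \<Phi> (x i) 0 = \<Phi> l 0" if "\<And>i. x i \<in> X" "l \<in> X" "ptlim x l" for x l
    using that by (rule \<Phi>_ptlim)
  fix E :: "(int^'d) set"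
  assume E: "finite E" "\<And>x x'. x \<in> X \<Longrightarrow> x' \<in> X \<Longrightarrow> (\<And>d. d \<in> E \<Longrightarrow> x d = x' d) \<Longrightarrow> \<Phi> x 0 = \<Phi> x' 0"
  show ?thesis
  proof (rule that[OF E(1)])
    fix x x' k k'
    assume x: "x \<in> X" "x' \<in> X" and eq: "\<And>d. d \<in> E \<Longrightarrow> x (k + d) = x' (k' + d)"
    then have "\<Phi> (shift k x) 0 = \<Phi> (shift k' x') 0"
      by (intro E(2) X_shift) (auto simp: shift_apply)
    then show "\<Phi> x k = \<Phi> x' k'"
      using x by (simp add: \<Phi>_shift) (simp add: shift_apply)
  qed
qed

lemma \<Phi>_pattern_occurs:
  assumes x: "x \<in> X" and P: "finite P"
  obtains N where "\<forall>m\<ge>N. \<forall>c\<in>C. \<exists>q. \<forall>k\<in>P. q + k \<in> c.Fn m \<and> c.Z m (\<lambda>_. c) (q + k) = \<Phi> x k"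
proof -
  obtain E where E: "finite E" "\<And>x x' k k'. x \<in> X \<Longrightarrow> x' \<in> X \<Longrightarrow>
    (\<And>d. d \<in> E \<Longrightarrow> x (k + d) = x' (k' + d)) \<Longrightarrow> \<Phi> x k = \<Phi> x' k'"
    using \<Phi>_window by blast
  \<comment> \<open>The windows around \<open>P\<close> determine the code on \<open>P\<close>;
    \<open>P\<close> itself is included to keep the occurrence inside the support.\<close>
  define P' where "P' = P \<union> (\<lambda>(k, d). k + d) ` (P \<times> E)"
  have "finite P'" using P E(1) by (simp add: P'_def)
  then obtain N where N: "\<forall>m\<ge>N. \<forall>b\<in>A. \<exists>q. \<forall>k\<in>P'. q + k \<in> Fn m \<and> Z m (\<lambda>_. b) (q + k) = x k"
    using pattern_occurs_eventually[OF x] by blast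
  have "\<exists>q. \<forall>k\<in>P. q + k \<in> c.Fn m \<and> c.Z m (\<lambda>_. c) (q + k) = \<Phi> x k" if m: "m \<ge> N" and c: "c \<in> C" for m c
  proof -
    obtain w where w: "w \<in> X" "c = \<Phi> w 0" using C_\<Phi>[OF c] .
    have "n * m \<ge> N" using n m by (metis le_trans mult_le_mono1 nat_mult_1)
    then obtain q where q: "\<forall>k\<in>P'. q + k \<in> Fn (n * m) \<and> Z (n * m) (\<lambda>_. w 0) (q + k) = x k"
      using N X_in[OF w(1)] by blast
    have q': "q + k \<in> Fn (n * m)" "Z (n * m) w (q + k) = x k" if "k \<in> P'" for k
      using q that Z_const[of "q + k" "n * m" w] by simp_all
    have "q + k \<in> c.Fn m \<and> c.Z m (\<lambda>_. c) (q + k) = \<Phi> x k" if k: "k \<in> P" for k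
    proof -
      have "Z (n * m) w (q + k + d) = x (k + d)" if "d \<in> E" for d
        using q'(2)[of "k + d"] k that by (force simp: P'_def add.assoc)
      then have "\<Phi> (Z (n * m) w) (q + k) = \<Phi> x k"
        using w x by (intro E(2)) (auto simp: Z_X)
      moreover have *: "q + k \<in> c.Fn m"
        using q'(1)[of k] k by (simp add: iter_support_mult P'_def)
      moreover have "c.Z m (\<lambda>_. c) (q + k) = \<Phi> (Z (n * m) w) (q + k)"
        using c.Z_const[OF *, of "\<Phi> w"] w by (simp add: \<Phi>_Z)
      ultimately show ?thesis by simp
    qed
    then show ?thesis by blast
  qed
  then show ?thesis using that by blast
qed

text \<open>Coded points lie in the new subshift by \<open>\<Phi>_pattern_occurs\<close>.
  Conversely, windows of \<open>z\<close> occur in iterates of letters, hence in coded points, and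
  compactness of \<open>X\<close> yields a preimage.\<close>

lemma \<Phi>_image: "c.X = \<Phi> ` X"
proof (intro set_eqI iffI)
  fix z assume "z \<in> \<Phi> ` X"
  then obtain x where x: "x \<in> X" "z = \<Phi> x" by blast
  show "z \<in> c.X"
    unfolding c.in_X_iff
  proof (intro conjI allI impI)
    show "z k \<in> C" for k using x \<Phi>_in by simp
  next
    fix P :: "(int^'d) set" assume "finite P"
    then obtain N where N: "\<forall>m\<ge>N. \<forall>c\<in>C. \<exists>q. \<forall>k\<in>P. q + k \<in> c.Fn m \<and> c.Z m (\<lambda>_. c) (q + k) = \<Phi> x k"
      using \<Phi>_pattern_occurs[OF x(1)] by blast
    obtain c where c: "c \<in> C" using c.A_nonempty by blast
    have "\<exists>q. \<forall>k\<in>P. q + k \<in> c.Fn (Suc N) \<and> c.Z (Suc N) (\<lambda>_. c) (q + k) = \<Phi> x k"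
      using N[rule_format, of "Suc N" c] c by simp
    then show "\<exists>m>0. \<exists>c\<in>C. \<exists>q. \<forall>k\<in>P. q + k \<in> c.Fn m \<and> c.Z m (\<lambda>_. c) (q + k) = z k"
      unfolding x(2) using c by blast
  qed
next
  fix z assume z: "z \<in> c.X"
  have "\<exists>x\<in>X. \<forall>k\<in>initial i. \<Phi> x k = z k" for i
  proof -
    obtain m c q where m: "c \<in> C" "\<forall>k\<in>initial i. q + k \<in> c.Fn m \<and> c.Z m (\<lambda>_. c) (q + k) = z k"
      using z finite_initial[of i] unfolding c.in_X_iff by blast
    obtain w where w: "w \<in> X" "c = \<Phi> w 0" using C_\<Phi>[OF m(1)] .
    have "\<Phi> (shift q (Z (n * m) w)) k = z k" if "k \<in> initial i" for k
    proof -
      have "\<Phi> (shift q (Z (n * m) w)) k = c.Z m (\<Phi> w) (q + k)"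
        using w by (simp add: \<Phi>_shift Z_X \<Phi>_Z) (simp add: shift_apply)
      also have "\<dots> = z k"
        using c.Z_const[of "q + k" m "\<Phi> w"] m(2) that w by simp
      finally show ?thesis .
    qed
    then show ?thesis using w X_shift Z_X by blast
  qed
  then obtain x where x: "\<And>i. x i \<in> X" "\<And>i k. k \<in> initial i \<Longrightarrow> \<Phi> (x i) k = z k"
    by metis
  obtain r l where r: "strict_mono r" "ptlim (\<lambda>i. x (r i)) l"
    using ptlim_compact[OF finite_A, of x] X_in[OF x(1)] by blast
  have l: "l \<in> X" using X_ptlim[OF _ r(2)] x(1) by blast
  have "ptlim (\<lambda>i. \<Phi> (x (r i))) z"
    using ptlim_subseq[OF ptlim_initial[of "\<lambda>i. \<Phi> (x i)"] r(1)] x(2) by blast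
  moreover have "ptlim (\<lambda>i. \<Phi> (x (r i))) (\<Phi> l)"
    unfolding ptlim_def[of "\<lambda>i. \<Phi> (x (r i))"] using \<Phi>_ptlim[OF x(1) l r(2)] by blast
  ultimately have "z = \<Phi> l" by (rule ptlim_unique)
  with l show "z \<in> \<Phi> ` X" by blast
qed

lemma primitive': "primitive_subst C (Lp n) (Fn n) \<zeta>'"
proof -
  have "\<exists>N. \<forall>m\<ge>N. \<forall>a\<in>C. \<exists>f\<in>c.Fn m. c.Z m (\<lambda>_. a) f = b" if b: "b \<in> C" for b
  proof -
    obtain x where x: "x \<in> X" "b = \<Phi> x 0" using C_\<Phi>[OF b] .
    obtain N where N: "\<forall>m\<ge>N. \<forall>c\<in>C. \<exists>q. \<forall>k\<in>{0}. q + k \<in> c.Fn m \<and> c.Z m (\<lambda>_. c) (q + k) = \<Phi> x k"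
      using \<Phi>_pattern_occurs[OF x(1), of "{0}"] by blast
    show ?thesis
    proof (intro exI[of _ N] allI impI ballI)
      fix m a assume "m \<ge> N" "a \<in> C"
      with N have "\<exists>q. \<forall>k\<in>{0}. q + k \<in> c.Fn m \<and> c.Z m (\<lambda>_. a) (q + k) = \<Phi> x k" by blast
      then show "\<exists>f\<in>c.Fn m. c.Z m (\<lambda>_. a) f = b" by (auto simp: x(2))
    qed
  qed
  then have "\<forall>b\<in>C. \<exists>N. \<forall>m\<ge>N. \<forall>a\<in>C. \<exists>f\<in>c.Fn m. c.Z m (\<lambda>_. a) f = b" by blast
  from bchoice[OF this] obtain N
    where N: "\<forall>b\<in>C. \<forall>m\<ge>N b. \<forall>a\<in>C. \<exists>f\<in>c.Fn m. c.Z m (\<lambda>_. a) f = b" ..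
  \<comment> \<open>The sum dominates every \<open>N b\<close>, and the successor makes the exponent
    positive.\<close>
  define m where "m = Suc (\<Sum>b\<in>C. N b)"
  have "N b \<le> m" if "b \<in> C" for b
    unfolding m_def using that c.finite_A by (intro le_SucI member_le_sum) auto
  then have "\<forall>a\<in>C. \<forall>b\<in>C. \<exists>f\<in>c.Fn m. c.Z m (\<lambda>_. a) f = b" using N by blast
  then show ?thesis
    unfolding primitive_subst_def c.iter_subst_Z by (intro exI[of _ m]) (simp add: m_def)
qed

lemma aperiodic': "aperiodic_subst C (Lp n) (Fn n) \<zeta>'"
  unfolding aperiodic_subst_def aperiodic_def
proof (intro ballI notI)
  fix z assume "z \<in> c.X" "\<exists>p. p \<noteq> 0 \<and> (\<forall>k. z (k + p) = z k)"
  then obtain x p where x: "x \<in> X" and p: "p \<noteq> 0" "\<And>k. \<Phi> x (k + p) = \<Phi> x k"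
    unfolding \<Phi>_image by auto
  have "\<tau> x (k + p) = \<tau> x k" for k
    using p(2)[of k] T'_\<Phi>[OF x] by metis
  moreover have "\<tau> x \<in> Y" using x \<tau>_image by blast
  ultimately show False
    using aperiodic_Y p(1) unfolding aperiodic_def by blast
qed

section \<open>The conjugacy onto the factor\<close>

lemma T'_in: "c \<in> C \<Longrightarrow> T' c \<in> B"
  by (rule C_\<Phi>[of c]) (auto simp: T'_\<Phi> intro!: Y_in simp flip: \<tau>_image)

definition \<tau>' :: "(int^'d \<Rightarrow> nat) \<Rightarrow> int^'d \<Rightarrow> 'b" where
  "\<tau>' z = (\<lambda>k. T' (z k))"

lemma \<tau>'_\<Phi>: "x \<in> X \<Longrightarrow> \<tau>' (\<Phi> x) = \<tau> x"
  by (simp add: \<tau>'_def T'_\<Phi>)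

lemma continuous_\<tau>':
  "continuous_map (subtopology (config_topology C) c.X) (subtopology (config_topology B) Y) \<tau>'"
  unfolding continuous_map_in_subtopology
proof
  show "continuous_map (subtopology (config_topology C) c.X) (config_topology B) \<tau>'"
    unfolding config_topology_def[of B] continuous_map_componentwise_UNIV
  proof
    fix k :: "int^'d"
    have "continuous_map (config_topology C) (discrete_topology C) (\<lambda>z. z k)"
      unfolding config_topology_def by (rule continuous_map_product_projection) simp
    moreover have "continuous_map (discrete_topology C) (discrete_topology B) T'"
      by (simp add: T'_in)
    ultimately have "continuous_map (config_topology C) (discrete_topology B) (T' \<circ> (\<lambda>z. z k))"
      by (rule continuous_map_compose)
    then show "continuous_map (subtopology (config_topology C) c.X) (discrete_topology B) (\<lambda>z. \<tau>' z k)"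
      by (simp add: \<tau>'_def o_def continuous_map_from_subtopology)
  qed
  show "\<tau>' \<in> topspace (subtopology (config_topology C) c.X) \<rightarrow> Y"
    using \<tau>_image by (auto simp: \<Phi>_image \<tau>'_\<Phi>)
qed

lemma conjugacy': "conjugacy C c.X B Y \<tau>'"
proof -
  have top: "topspace (subtopology (config_topology C) c.X) = c.X"
    "topspace (subtopology (config_topology B) Y) = Y"
    using c.X_in Y_in by (auto simp: topspace_config_topology)
  have image: "\<tau>' ` c.X = Y"
    by (auto simp: \<Phi>_image \<tau>'_\<Phi> image_image simp flip: \<tau>_image)
  have inv: "\<psi> (\<tau>' z) = z" if "z \<in> c.X" for z
    using that by (auto simp: \<Phi>_image \<tau>'_\<Phi>)
  have inv': "\<tau>' (\<psi> y) = y" if "y \<in> Y" for y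
    using that by (auto simp: \<tau>'_\<Phi> simp flip: \<tau>_image)
  have "compact_space (config_topology C)"
    unfolding config_topology_def compact_space_product_topology
    using c.finite_A by (simp add: compact_space_discrete_topology)
  then have "compact_space (subtopology (config_topology C) c.X)"
    by (intro compact_space_subtopology closedin_compact_space c.closedin_X)
  moreover have "Hausdorff_space (subtopology (config_topology B) Y)"
    unfolding config_topology_def
    by (intro Hausdorff_space_subtopology) (simp add: Hausdorff_space_product_topology)
  moreover have "inj_on \<tau>' c.X"
    by (rule inj_on_inverseI) (rule inv)
  \<comment> \<open>A continuous bijection from a compact space to a Hausdorff space; its inverse is
    then identified with \<psi>, whose compatibility with shifts comes from
    \<open>\<Phi>_shift\<close>.\<close>
  ultimately have "homeomorphic_map (subtopology (config_topology C) c.X) (subtopology (config_topology B) Y) \<tau>'"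
    using image by (intro continuous_imp_homeomorphic_map continuous_\<tau>') (simp_all only: top)
  then obtain \<sigma> where \<sigma>: "continuous_map (subtopology (config_topology B) Y) (subtopology (config_topology C) c.X) \<sigma>"
    "\<And>z. z \<in> c.X \<Longrightarrow> \<sigma> (\<tau>' z) = z"
    unfolding homeomorphic_map_maps homeomorphic_maps_def top by blast
  have "\<sigma> y = \<psi> y" if "y \<in> Y" for y
    using that \<sigma>(2) inv by (auto simp flip: image)
  then have cont: "continuous_map (subtopology (config_topology B) Y) (subtopology (config_topology C) c.X) \<psi>"
    by (intro continuous_map_eq[OF \<sigma>(1)]) (simp only: top)
  have "factor_map C c.X B Y \<tau>'"
    unfolding factor_map_def using continuous_\<tau>' image by (simp add: \<tau>'_def shift_def)
  moreover have "factor_map B Y C c.X \<psi>"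
    unfolding factor_map_def
  proof (intro conjI allI ballI cont)
    show "\<psi> ` Y = c.X"
      by (auto simp: \<Phi>_image simp flip: \<tau>_image)
    show "\<psi> (shift m y) = shift m (\<psi> y)" if "y \<in> Y" for m y
      using that by (auto simp: \<tau>_shift[symmetric] \<Phi>_shift simp flip: \<tau>_image)
  qed
  ultimately show ?thesis
    unfolding conjugacy_def using inv inv' by blast
qed

end

theorem theorem3p26:
  fixes A :: "'a set" and B :: "'b set"
    and L :: "int^'d::finite^'d" and F\<^sub>1 :: "(int^'d) set"
    and \<zeta> :: "'a \<Rightarrow> int^'d \<Rightarrow> 'a"
    and Y :: "(int^'d \<Rightarrow> 'b) set"
  assumes "constant_shape_substitution A L F\<^sub>1 \<zeta>"
    and "primitive_subst A L F\<^sub>1 \<zeta>"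
    and "aperiodic_subst A L F\<^sub>1 \<zeta>"
    and "finite B"
    and "aperiodic_symbolic_factor A (subst_shift A L F\<^sub>1 \<zeta>) B Y"
  shows "\<exists>n\<ge>1. \<exists>(C :: nat set) \<zeta>'.
           constant_shape_substitution C (mat_pow L n) (iter_support L F\<^sub>1 n) \<zeta>' \<and>
           primitive_subst C (mat_pow L n) (iter_support L F\<^sub>1 n) \<zeta>' \<and>
           aperiodic_subst C (mat_pow L n) (iter_support L F\<^sub>1 n) \<zeta>' \<and>
           (\<exists>\<tau>' T'.
              conjugacy C (subst_shift C (mat_pow L n) (iter_support L F\<^sub>1 n) \<zeta>') B Y \<tau>' \<and>
              (\<forall>c\<in>C. T' c \<in> B) \<and>
              (\<forall>x \<in> subst_shift C (mat_pow L n) (iter_support L F\<^sub>1 n) \<zeta>'. \<forall>k. \<tau>' x k = T' (x k)))"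
proof -
  interpret primitive_css A L F\<^sub>1 \<zeta>
    using assms(1,2) by unfold_locales
  obtain \<tau> where \<tau>: "factor_map A X B Y \<tau>"
    using assms(5) unfolding aperiodic_symbolic_factor_def by blast
  have cont: "continuous_map (subtopology (config_topology A) X) (subtopology (config_topology B) Y) \<tau>"
    using \<tau> by (simp add: factor_map_def)
  obtain D\<^sub>0 where D0: "finite D\<^sub>0"
    "\<forall>x\<in>X. \<forall>x'\<in>X. (\<forall>k\<in>D\<^sub>0. x k = x' k) \<longrightarrow> \<tau> x 0 = \<tau> x' 0"
    using continuous_window[OF cont] .
  \<comment> \<open>With 0 in the window, D + D contains \<open>D\<close>, as the bound on phases
    requires.\<close>
  have "finite (insert 0 D\<^sub>0)" using D0 by simp
  then obtain D where D: "finite D" "insert 0 D\<^sub>0 \<subseteq> D"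
    "\<And>n f f' f'' d. f \<in> Fn n \<Longrightarrow> f' \<in> Fn n \<Longrightarrow> f'' \<in> Fn n \<Longrightarrow> d \<in> D \<Longrightarrow>
      \<exists>e\<in>D. \<exists>g\<in>Fn n. f + f' - f'' + d = Lp n *v e + g"
    using stable_window by blast
  interpret css_factor A L F\<^sub>1 \<zeta> B Y \<tau> D
  proof
    show "factor_map A X B Y \<tau>" by (rule \<tau>)
    show "aperiodic Y" using assms(5) by (simp add: aperiodic_symbolic_factor_def)
    show "finite D" by (rule D(1))
    show "0 \<in> D" using D(2) by simp
    show "\<exists>e\<in>D. \<exists>g\<in>Fn n. f + f' - f'' + d = Lp n *v e + g"
      if "f \<in> Fn n" "f' \<in> Fn n" "f'' \<in> Fn n" "d \<in> D" for n f f' f'' d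
      using that by (rule D(3))
    show "\<tau> x 0 = \<tau> x' 0" if "x \<in> X" "x' \<in> X" "\<And>d. d \<in> D \<Longrightarrow> x d = x' d" for x x'
    proof -
      have "\<forall>k\<in>D\<^sub>0. x k = x' k" using that(3) D(2) by blast
      with D0(2) that(1,2) show ?thesis by blast
    qed
  qed
  obtain n where n: "n \<ge> 1" "level_eq (n + n) = level_eq n"
    using stable_level .
  obtain code :: "(int^'d \<Rightarrow> 'a) \<Rightarrow> int^'d \<Rightarrow> nat"
    where code: "\<And>x x' g g'. x \<in> X \<Longrightarrow> x' \<in> X \<Longrightarrow> g \<in> Fn n \<Longrightarrow> g' \<in> Fn n \<Longrightarrow>
        code x g = code x' g' \<longleftrightarrow> g = g' \<and> (x, x') \<in> level_eq n"
      "finite {code x g | x g. x \<in> X \<and> g \<in> Fn n}"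
    using finite_coding by blast
  have "Y \<subseteq> topspace (config_topology B)"
    using assms(5) by (auto simp: aperiodic_symbolic_factor_def subshift_def dest: closedin_subset)
  then have Y_in: "y k \<in> B" if "y \<in> Y" for y k
    using that by (auto simp: topspace_config_topology)
  interpret coded_factor A L F\<^sub>1 \<zeta> B Y \<tau> D n code
    by unfold_locales (use n code Y_in in auto)
  show ?thesis
    using n(1) css' primitive' aperiodic' conjugacy' T'_in by (metis \<tau>'_def)
qed

end
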